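(* Let $\pi$ be a probability distribution on $[q]^n$. There exists an algorithm that, given oracle access to the conditional marginals $\pi_i(\cdot\mid X_S)$ of $\pi$ through density queries and sampling queries (defined in the context), outputs a sample distributed exactly according to $\pi$. The expected number of rounds is $O(\sqrt{n\log q}\,\log^3 n)$ and the expected number of queries is $O(n\log n)$.
   Context: Density query: given $S\subseteq[n]$, an index $i\notin S$, a configuration $x_S\in[q]^S$ with $\Pr_{X\sim\pi}[X_S=x_S]>0$, and $x_i\in[q]$, the oracle returns $\pi_i(x_i\mid X_S=x_S)=\Pr_{X\sim\pi}[X_i=x_i\mid X_S=x_S]$. Sampling query: given $S\subseteq[n]$, $i\notin S$ and $x_S\in[q]^S$ with $\Pr_{X\sim\pi}[X_S=x_S]>0$, the oracle returns a sample $x_i\sim\pi_i(\cdot\mid X_S=x_S)$. The algorithm interacts with the oracles in rounds: in each round it may send any number of queries in parallel, which may depend only on answers from previous rounds. The number of rounds is the number of such sequential rounds; the number of queries is the total number of queries issued. *)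

theory Defs
  imports "HOL-Probability.Probability"
begin

text \<open>
  A partial configuration \<open>x\<^sub>S \<in> [q]\<^sup>S\<close> is a finite map whose domain is \<open>S\<close>, with \<open>[n] = {1..n}\<close> and
  \<open>[q] = {1..q}\<close>. The event \<open>X\<^sub>S = x\<^sub>S\<close> is then \<open>x\<^sub>S \<subseteq>\<^sub>m X\<close>.
\<close>

type_synonym config = "nat \<rightharpoonup> nat"

definition configs :: "nat set \<Rightarrow> nat \<Rightarrow> config set" where
  "configs S q = {x. dom x = S \<and> ran x \<subseteq> {1..q}}"

definition agreeing :: "config \<Rightarrow> config set" where
  "agreeing x = {X. x \<subseteq>\<^sub>m X}"

definition cond_marginal :: "config pmf \<Rightarrow> nat \<Rightarrow> config \<Rightarrow> nat pmf" where
  "cond_marginal \<pi> i x = map_pmf (\<lambda>X. the (X i)) (cond_pmf \<pi> (agreeing x))"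

datatype "query" = Density config nat nat | Sampling config nat

datatype answer = Prob real | Val nat

definition admissible :: "nat \<Rightarrow> nat \<Rightarrow> config pmf \<Rightarrow> config \<Rightarrow> nat \<Rightarrow> bool" where
  "admissible n q \<pi> x i \<longleftrightarrow>
     (\<exists>S. S \<subseteq> {1..n} \<and> i \<in> {1..n} - S \<and> x \<in> configs S q \<and>
          measure_pmf.prob \<pi> (agreeing x) > 0)"

text \<open>
  An oracle assigns to each query the law of its answer. Queries outside the stated domain, in
  particular those that condition on an event of probability zero, may be issued, but nothing is
  promised about their answers. Several queries of one round may depend on each other's outcome for
  their admissibility, so an algorithm cannot in general avoid issuing such queries.
\<close>

definition conditional_oracle ::
  "nat \<Rightarrow> nat \<Rightarrow> config pmf \<Rightarrow> (query \<Rightarrow> answer pmf) \<Rightarrow> bool" where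
  "conditional_oracle n q \<pi> orc \<longleftrightarrow>
     (\<forall>x i. admissible n q \<pi> x i \<longrightarrow>
        (\<forall>a\<in>{1..q}. orc (Density x i a) = return_pmf (Prob (pmf (cond_marginal \<pi> i x) a))) \<and>
        orc (Sampling x i) = map_pmf Val (cond_marginal \<pi> i x))"

text \<open>The queries of one round are answered independently, repeated ones included.\<close>

primrec answers :: "(query \<Rightarrow> answer pmf) \<Rightarrow> query list \<Rightarrow> answer list pmf" where
  "answers orc [] = return_pmf []"
| "answers orc (c # cs) =
     bind_pmf (orc c) (\<lambda>a. bind_pmf (answers orc cs) (\<lambda>as. return_pmf (a # as)))"

text \<open>
  A randomized adaptive algorithm: it draws, with its own coins, either a final output or a finite
  batch of parallel queries together with a continuation that receives the answers. All memory,
  including past coins, is kept in the continuation. The type is coinductive, so that the number of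
  rounds need not be bounded.
\<close>

datatype 'c action = Output config | Round "query list" "answer list \<Rightarrow> 'c"

codatatype algorithm = Algorithm (next_action: "algorithm action pmf")

datatype outcome = Outcome (result: config) (rounds: nat) (queries: nat)

text \<open>
  The joint law of the output and of the numbers of rounds and queries used. It is the least fixed
  point, hence the missing mass of this subprobability is the probability of running forever.
\<close>

partial_function (spmf) exec :: "(query \<Rightarrow> answer pmf) \<Rightarrow> algorithm \<Rightarrow> outcome spmf" where
  "exec orc A = bind_pmf (next_action A) (\<lambda>s. case s of
       Output x \<Rightarrow> return_spmf (Outcome x 0 0)
     | Round cs k \<Rightarrow> bind_pmf (answers orc cs) (\<lambda>as.
         map_spmf (\<lambda>t. Outcome (result t) (rounds t + 1) (queries t + length cs))
           (exec orc (k as))))"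

definition outputs_exactly :: "(query \<Rightarrow> answer pmf) \<Rightarrow> algorithm \<Rightarrow> config pmf \<Rightarrow> bool" where
  "outputs_exactly orc A \<pi> \<longleftrightarrow> map_spmf result (exec orc A) = spmf_of_pmf \<pi>"

text \<open>
  Runs without output contribute nothing below. These are the true expectations whenever the
  algorithm halts almost surely, which \<^const>\<open>outputs_exactly\<close> entails.
\<close>

definition expected_rounds :: "(query \<Rightarrow> answer pmf) \<Rightarrow> algorithm \<Rightarrow> ennreal" where
  "expected_rounds orc A = (\<integral>\<^sup>+ t. of_nat (rounds t) \<partial>measure_spmf (exec orc A))"

definition expected_queries :: "(query \<Rightarrow> answer pmf) \<Rightarrow> algorithm \<Rightarrow> ennreal" where
  "expected_queries orc A = (\<integral>\<^sup>+ t. of_nat (queries t) \<partial>measure_spmf (exec orc A))"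

end

theory Submission
  imports Defs
begin

text \<open>
  Reveal the coordinates in a uniformly random order. A block of coordinates is sampled, given the
  prefix \<open>h\<close>, by speculating that its coordinates are conditionally independent: a draft \<open>y\<close> from the
  product \<open>\<nu>\<close> of the conditional marginals costs one round, the density queries give both \<open>\<nu> y\<close> and the
  true probability \<open>\<mu> y\<close> in a second round, and \<open>y\<close> is accepted with probability \<open>min 1 (\<mu> y / \<nu> y)\<close>.
  With probability \<open>t\<close>, the total variation distance of \<open>\<mu>\<close> and \<open>\<nu>\<close>, it is rejected, and a sample from
  the normalized positive part of \<open>\<mu> - \<nu>\<close> is needed instead. It is obtained by rejection from samples of
  \<open>\<mu>\<close>, which are produced recursively by halving the block. One attempt succeeds with probability \<open>t\<close>,
  so a block makes one recursive call in expectation, which gives the query bound. The attempts run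
  in parallel, in batches growing by a factor \<open>1 + 1 / L\<close> with \<open>L\<close> the depth of the recursion: the
  overshoot then costs only a constant factor over all levels. When a huge number of attempts has failed,
  the residual distribution is computed exactly from the densities of all configurations; so all
  executions are finite, and this case is too unlikely to matter.

  The number of rounds beyond a constant is additive over the recursion tree if the maximum over
  parallel branches is bounded by the sum, because \<open>t\<close> times the number of attempts is about one.
  It is thus governed by the sum over all blocks of the expected \<open>t\<close>. By a Pinsker
  inequality this expectation is at most \<open>c + K / c\<close>, where \<open>K\<close> is the average relative entropy of \<open>\<mu>\<close> with
  respect to \<open>\<nu>\<close>. For a random order and blocks of size \<open>m\<close>, the sum of the \<open>K\<close> over all blocks telescopes to
  at most \<open>m * ln q\<close>, since the average conditional entropies decrease along the order. Taking \<open>c\<close>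
  proportional to \<open>m\<close> gives \<open>O(sqrt (n * ln q))\<close> on each of the \<open>L\<close> levels, and the at most
  \<open>O(L\<^sup>2)\<close> relevant batches account for the remaining logarithms.
\<close>

section \<open>Interactive programs\<close>

text \<open>Well-founded counterpart of \<open>algorithm\<close>: laws and costs can be defined by
  primitive recursion, and no run is infinite. Coins are drawn only after a batch of
  answers.\<close>

datatype 'r prog = Ret 'r | Ask "query list" "answer list \<Rightarrow> 'r prog pmf"

primrec bindp :: "'a prog \<Rightarrow> ('a \<Rightarrow> 'b prog) \<Rightarrow> 'b prog" where
  "bindp (Ret x) f = f x"
| "bindp (Ask cs k) f = Ask cs (\<lambda>as. map_pmf (\<lambda>p. bindp p f) (k as))"

text \<open>Lockstep execution: one batch carries the queries of both branches, and
  \<open>take\<close> and \<open>drop\<close> split the answers again. Once a branch has ended, the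
  other continues alone. Recursion on the first argument requires that \<open>par\<close> is mapped
  over its continuation before the second program is supplied.\<close>

primrec par :: "'a prog \<Rightarrow> 'b prog \<Rightarrow> ('a \<times> 'b) prog" where
  "par (Ret x) B = bindp B (\<lambda>y. Ret (x, y))"
| "par (Ask cs k) B = (case B of
      Ret y \<Rightarrow> bindp (Ask cs k) (\<lambda>x. Ret (x, y))
    | Ask cs' k' \<Rightarrow> Ask (cs @ cs') (\<lambda>as.
        bind_pmf (map_pmf par (k (take (length cs) as))) (\<lambda>P.
          map_pmf P (k' (drop (length cs) as)))))"

primrec run :: "(query \<Rightarrow> answer pmf) \<Rightarrow> 'r prog \<Rightarrow> ('r \<times> nat \<times> nat) pmf" where
  "run orc (Ret x) = return_pmf (x, 0, 0)"
| "run orc (Ask cs k) = bind_pmf (answers orc cs) (\<lambda>as.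
     bind_pmf (map_pmf (run orc) (k as)) (map_pmf (\<lambda>(x, r, c). (x, r + 1, c + length cs))))"

lemma run_Ask:
  "run orc (Ask cs k) = bind_pmf (answers orc cs) (\<lambda>as. bind_pmf (k as) (\<lambda>p.
     map_pmf (\<lambda>(x, r, c). (x, r + 1, c + length cs)) (run orc p)))"
  by (simp add: bind_map_pmf)

section \<open>Translation of programs into algorithms\<close>

primrec to_algorithm :: "config prog \<Rightarrow> algorithm" where
  "to_algorithm (Ret x) = Algorithm (return_pmf (Output x))"
| "to_algorithm (Ask cs k) = Algorithm (return_pmf (Round cs (\<lambda>as.
     Algorithm (bind_pmf (map_pmf to_algorithm (k as)) next_action))))"

text \<open>\<open>exec\<close> sees an algorithm only through \<open>next_action\<close>, so a
  random choice of the algorithm can be moved out of its first action. The coins that a program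
  draws after a batch are of this kind.\<close>

lemma exec_bind:
  "exec orc (Algorithm (bind_pmf M next_action)) = bind_pmf M (exec orc)"
proof -
  have "exec orc (Algorithm (bind_pmf M next_action)) = bind_pmf M (\<lambda>A. bind_pmf (next_action A) (\<lambda>s. case s of
       Output x \<Rightarrow> return_spmf (Outcome x 0 0)
     | Round cs k \<Rightarrow> bind_pmf (answers orc cs) (\<lambda>as.
         map_spmf (\<lambda>t. Outcome (result t) (rounds t + 1) (queries t + length cs))
           (exec orc (k as)))))"
    by (subst exec.simps) (simp add: bind_assoc_pmf)
  also have "\<dots> = bind_pmf M (exec orc)"
    by (intro bind_pmf_cong refl exec.simps[symmetric])
  finally show ?thesis .
qed

lemma exec_bind_map:
  "exec orc (Algorithm (bind_pmf M (\<lambda>x. next_action (f x)))) = bind_pmf M (\<lambda>x. exec orc (f x))"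
  using exec_bind[of orc "map_pmf f M"] by (simp add: bind_map_pmf)

text \<open>All runs of a program are finite, hence no mass is lost and the least fixed point is a
  genuine distribution.\<close>

lemma exec_to_algorithm:
  "exec orc (to_algorithm p) = spmf_of_pmf (map_pmf (\<lambda>(x, r, c). Outcome x r c) (run orc p))"
proof (induction p)
  case (Ret x)
  show ?case by (subst exec.simps) (simp add: bind_return_pmf)
next
  case (Ask cs k)
  have "exec orc (to_algorithm (Ask cs k)) = bind_pmf (answers orc cs) (\<lambda>as.
     map_spmf (\<lambda>t. Outcome (result t) (rounds t + 1) (queries t + length cs))
       (bind_pmf (k as) (\<lambda>p. exec orc (to_algorithm p))))"
    by (subst exec.simps) (simp add: bind_return_pmf exec_bind_map bind_map_pmf)
  also have "\<dots> = bind_pmf (answers orc cs) (\<lambda>as.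
     map_spmf (\<lambda>t. Outcome (result t) (rounds t + 1) (queries t + length cs))
       (bind_pmf (k as) (\<lambda>p. spmf_of_pmf (map_pmf (\<lambda>(x, r, c). Outcome x r c) (run orc p)))))"
    using Ask by (auto intro!: bind_pmf_cong arg_cong[where f = "map_spmf _"])
  also have "\<dots> = spmf_of_pmf (map_pmf (\<lambda>(x, r, c). Outcome x r c) (run orc (Ask cs k)))"
    by (simp add: run_Ask spmf_of_pmf_def map_bind_pmf pmf.map_comp o_def case_prod_unfold del: run.simps)
  finally show ?case .
qed

section \<open>Composition of runs\<close>

lemma answers_append:
  "answers orc (cs @ ds) = bind_pmf (answers orc cs) (\<lambda>as. map_pmf ((@) as) (answers orc ds))"
  by (induction cs) (simp_all add: bind_assoc_pmf bind_return_pmf map_pmf_def bind_return_pmf')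

lemma length_answers: "as \<in> set_pmf (answers orc cs) \<Longrightarrow> length as = length cs"
  by (induction cs arbitrary: as) auto

lemma run_bindp:
  "run orc (bindp A f) = bind_pmf (run orc A) (\<lambda>(x, r, c).
     map_pmf (\<lambda>(y, r', c'). (y, r + r', c + c')) (run orc (f x)))"
proof (induction A)
  case (Ret x)
  show ?case by (simp add: bind_return_pmf case_prod_unfold)
next
  case (Ask cs k)
  have "run orc (bindp (Ask cs k) f) = bind_pmf (answers orc cs) (\<lambda>as. bind_pmf (k as) (\<lambda>p.
     map_pmf (\<lambda>(x, r, c). (x, r + 1, c + length cs)) (run orc (bindp p f))))"
    by (simp add: run_Ask bind_map_pmf del: run.simps)
  also have "\<dots> = bind_pmf (answers orc cs) (\<lambda>as. bind_pmf (k as) (\<lambda>p.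
     map_pmf (\<lambda>(x, r, c). (x, r + 1, c + length cs)) (bind_pmf (run orc p) (\<lambda>(x, r, c).
     map_pmf (\<lambda>(y, r', c'). (y, r + r', c + c')) (run orc (f x))))))"
    by (intro bind_pmf_cong refl arg_cong[where f = "map_pmf _"] Ask) auto
  also have "\<dots> = bind_pmf (run orc (Ask cs k)) (\<lambda>(x, r, c).
     map_pmf (\<lambda>(y, r', c'). (y, r + r', c + c')) (run orc (f x)))"
    by (simp add: run_Ask bind_assoc_pmf map_bind_pmf bind_map_pmf pmf.map_comp o_def
        case_prod_unfold ac_simps del: run.simps)
  finally show ?case .
qed

abbreviation "mapp f A \<equiv> bindp A (\<lambda>x. Ret (f x))"

lemma run_mapp: "run orc (mapp f A) = map_pmf (\<lambda>(x, r, c). (f x, r, c)) (run orc A)"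
  by (simp add: run_bindp map_pmf_def bind_return_pmf case_prod_unfold)

text \<open>Answers within a round are independent, so the two branches stay independent although
  their rounds are merged. The proof moves the draws of the second branch behind those of the
  first.\<close>

lemma run_par:
  "run orc (par A B) = map_pmf (\<lambda>((x, r, c), (y, r', c')). ((x, y), max r r', c + c'))
     (pair_pmf (run orc A) (run orc B))"
proof (induction A arbitrary: B)
  case (Ret x)
  show ?case by (simp add: run_mapp pair_return_pmf1 pmf.map_comp o_def case_prod_unfold)
next
  case (Ask cs k)
  show ?case
  proof (cases B)
    case (Ret y)
    then show ?thesis
      using run_mapp[of orc "Ask cs k" "\<lambda>x. (x, y)"]
      by (simp add: pair_return_pmf2 pmf.map_comp o_def case_prod_unfold)
  next
    case B: (Ask ds l)
    have "run orc (par (Ask cs k) B) = bind_pmf (answers orc cs) (\<lambda>as. bind_pmf (answers orc ds) (\<lambda>bs.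
      bind_pmf (k as) (\<lambda>p. bind_pmf (l bs) (\<lambda>p'. 
     map_pmf (\<lambda>(x, r, c). (x, r + 1, c + length (cs @ ds))) (run orc (par p p'))))))"
      unfolding B
      by (simp add: run_Ask bind_map_pmf bind_assoc_pmf answers_append length_answers
          del: run.simps cong: bind_pmf_cong_simp)
    also have "\<dots> = bind_pmf (answers orc cs) (\<lambda>as. bind_pmf (answers orc ds) (\<lambda>bs.
      bind_pmf (k as) (\<lambda>p. bind_pmf (l bs) (\<lambda>p'. 
     map_pmf (\<lambda>(x, r, c). (x, r + 1, c + length (cs @ ds))) 
      (map_pmf (\<lambda>((x, r, c), (y, r', c')). ((x, y), max r r', c + c'))
     (pair_pmf (run orc p) (run orc p')))))))"
      by (intro bind_pmf_cong refl arg_cong[where f = "map_pmf _"] Ask) auto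
    also have "\<dots> = bind_pmf (answers orc cs) (\<lambda>as. bind_pmf (k as) (\<lambda>p. bind_pmf (answers orc ds) (\<lambda>bs.
       bind_pmf (l bs) (\<lambda>p'. 
     map_pmf (\<lambda>(x, r, c). (x, r + 1, c + length (cs @ ds))) 
      (map_pmf (\<lambda>((x, r, c), (y, r', c')). ((x, y), max r r', c + c'))
     (pair_pmf (run orc p) (run orc p')))))))"
      by (subst bind_commute_pmf) rule
    also have "\<dots> = bind_pmf (answers orc cs) (\<lambda>as. bind_pmf (k as) (\<lambda>p. bind_pmf (run orc p) (\<lambda>v. bind_pmf (answers orc ds) (\<lambda>bs.
       bind_pmf (l bs) (\<lambda>p'. bind_pmf (run orc p') (\<lambda>w.
     return_pmf ((fst v, fst w), max (fst (snd v)) (fst (snd w)) + 1, snd (snd v) + snd (snd w) + length (cs @ ds))))))))"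
    proof -
      have *: "bind_pmf (run orc p) (\<lambda>v. bind_pmf (answers orc ds) (\<lambda>bs.
       bind_pmf (l bs) (\<lambda>p'. bind_pmf (run orc p') (F v)))) = 
         bind_pmf (answers orc ds) (\<lambda>bs.
       bind_pmf (l bs) (\<lambda>p'. bind_pmf (run orc p) (\<lambda>v. bind_pmf (run orc p') (F v))))" for p F
        by (subst bind_commute_pmf, subst (2) bind_commute_pmf) rule
      show ?thesis unfolding *
        by (simp add: pair_pmf_def map_pmf_def bind_assoc_pmf bind_return_pmf case_prod_unfold)
    qed
    also have "\<dots> = map_pmf (\<lambda>((x, r, c), (y, r', c')). ((x, y), max r r', c + c'))
     (pair_pmf (run orc (Ask cs k)) (run orc B))"
      unfolding B run_Ask
      by (simp add: pair_pmf_def map_pmf_def bind_assoc_pmf bind_return_pmf case_prod_unfold ac_simps)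
    finally show ?thesis .
  qed
qed

section \<open>Laws, excess rounds and expected queries\<close>

definition law :: "(query \<Rightarrow> answer pmf) \<Rightarrow> 'r prog \<Rightarrow> 'r pmf" where
  "law orc A = map_pmf fst (run orc A)"

text \<open>Subtracting the constant before taking expectations is what makes the bound on
  parallel composition below additive without charging the common part once per branch.\<close>

definition excess :: "(query \<Rightarrow> answer pmf) \<Rightarrow> nat \<Rightarrow> 'r prog \<Rightarrow> ennreal" where
  "excess orc d A = (\<integral>\<^sup>+(x, r, c). of_nat (r - d) \<partial>run orc A)"

definition cost :: "(query \<Rightarrow> answer pmf) \<Rightarrow> 'r prog \<Rightarrow> ennreal" where
  "cost orc A = (\<integral>\<^sup>+(x, r, c). of_nat c \<partial>run orc A)"

lemma law_Ret [simp]: "law orc (Ret x) = return_pmf x"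
  by (simp add: law_def)

lemma law_Ask: "law orc (Ask cs k) = bind_pmf (answers orc cs) (\<lambda>as. bind_pmf (k as) (law orc))"
  by (simp add: law_def[abs_def] run_Ask map_bind_pmf pmf.map_comp o_def case_prod_unfold del: run.simps)

lemma law_bindp [simp]: "law orc (bindp A f) = bind_pmf (law orc A) (\<lambda>x. law orc (f x))"
  by (simp add: law_def run_bindp map_bind_pmf bind_map_pmf pmf.map_comp o_def case_prod_unfold)

lemma law_par [simp]: "law orc (par A B) = pair_pmf (law orc A) (law orc B)"
  unfolding law_def run_par
  by (simp add: map_pair[symmetric] pmf.map_comp o_def case_prod_unfold)

lemma excess_Ret [simp]: "excess orc d (Ret x) = 0"
  by (simp add: excess_def)

text \<open>Truncated subtraction satisfies
  \<open>(a + b) - (d + e) \<le> (a - d) + (b - e)\<close>, so allowances add up in sequential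
  composition.\<close>

lemma excess_bindp:
  "excess orc (d + e) (bindp A f) \<le> excess orc d A + (\<integral>\<^sup>+x. excess orc e (f x) \<partial>law orc A)"
proof -
  have "excess orc (d + e) (bindp A f)
    = (\<integral>\<^sup>+v. \<integral>\<^sup>+w. of_nat (fst (snd v) + fst (snd w) - (d + e)) \<partial>run orc (f (fst v)) \<partial>run orc A)"
    by (simp add: excess_def run_bindp case_prod_unfold)
  also have "\<dots> \<le> (\<integral>\<^sup>+v. \<integral>\<^sup>+w. of_nat (fst (snd v) - d) + of_nat (fst (snd w) - e) \<partial>run orc (f (fst v)) \<partial>run orc A)"
    by (intro nn_integral_mono) (simp flip: of_nat_add)
  also have "\<dots> = excess orc d A + (\<integral>\<^sup>+x. excess orc e (f x) \<partial>law orc A)"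
    by (simp add: excess_def law_def nn_integral_add case_prod_unfold)
  finally show ?thesis .
qed

lemma excess_mapp [simp]: "excess orc d (mapp f A) = excess orc d A"
  by (simp add: excess_def run_mapp case_prod_unfold)

text \<open>A maximum exceeds \<open>d\<close> by at most the sum of the separate excesses, while
  the allowance \<open>d\<close> itself is not doubled.\<close>

lemma excess_par: "excess orc d (par A B) \<le> excess orc d A + excess orc d B"
proof -
  have "excess orc d (par A B)
    = (\<integral>\<^sup>+v. \<integral>\<^sup>+w. of_nat (max (fst (snd v)) (fst (snd w)) - d) \<partial>run orc B \<partial>run orc A)"
    by (simp add: excess_def run_par nn_integral_pair_pmf' case_prod_unfold)
  also have "\<dots> \<le> (\<integral>\<^sup>+v. \<integral>\<^sup>+w. of_nat (fst (snd v) - d) + of_nat (fst (snd w) - d) \<partial>run orc B \<partial>run orc A)"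
    by (intro nn_integral_mono) (simp flip: of_nat_add)
  also have "\<dots> = excess orc d A + excess orc d B"
    by (simp add: excess_def nn_integral_add case_prod_unfold)
  finally show ?thesis .
qed

lemma excess_antimono: "d \<le> e \<Longrightarrow> excess orc e A \<le> excess orc d A"
  unfolding excess_def by (intro nn_integral_mono) (auto split: prod.splits)

lemma excess_0_le: "excess orc 0 A \<le> of_nat d + excess orc d A"
proof -
  have "excess orc 0 A \<le> (\<integral>\<^sup>+v. of_nat d + of_nat (fst (snd v) - d) \<partial>run orc A)"
    unfolding excess_def by (intro nn_integral_mono) (auto split: prod.splits simp flip: of_nat_add)
  then show ?thesis by (simp add: excess_def nn_integral_add case_prod_unfold)
qed

lemma cost_Ret [simp]: "cost orc (Ret x) = 0"
  by (simp add: cost_def)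

lemma cost_bindp [simp]:
  "cost orc (bindp A f) = cost orc A + (\<integral>\<^sup>+x. cost orc (f x) \<partial>law orc A)"
  by (simp add: cost_def law_def run_bindp nn_integral_add case_prod_unfold)

lemma cost_par [simp]: "cost orc (par A B) = cost orc A + cost orc B"
  by (simp add: cost_def run_par nn_integral_pair_pmf' nn_integral_add case_prod_unfold)

lemma excess_Ask_Ret:
  "0 < d \<Longrightarrow> excess orc d (Ask cs (\<lambda>as. map_pmf (\<lambda>x. Ret (g as x)) (f as))) = 0"
  by (simp add: excess_def run_Ask del: run.simps) (simp add: bind_map_pmf)

lemma cost_Ask_Ret:
  "cost orc (Ask cs (\<lambda>as. map_pmf (\<lambda>x. Ret (g as x)) (f as))) = of_nat (length cs)"
  by (simp add: cost_def run_Ask del: run.simps) (simp add: bind_map_pmf)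

lemma law_Ask_Ret:
  "law orc (Ask cs (\<lambda>as. map_pmf (\<lambda>x. Ret (g as x)) (f as)))
    = bind_pmf (answers orc cs) (\<lambda>as. map_pmf (g as) (f as))"
  by (simp add: law_Ask bind_map_pmf map_pmf_def[symmetric])

section \<open>Repeated parallel attempts\<close>

text \<open>A program can draw coins only behind an \<open>Ask\<close>, so a coin toss is charged
  one round without queries.\<close>

definition coin :: "'a pmf \<Rightarrow> 'a prog" where
  "coin p = Ask [] (\<lambda>_. map_pmf Ret p)"

lemma law_coin [simp]: "law orc (coin p) = p"
  using law_Ask_Ret[of orc "[]" "\<lambda>_ x. x" "\<lambda>_. p"] by (simp add: coin_def bind_return_pmf)

lemma excess_coin [simp]: "0 < d \<Longrightarrow> excess orc d (coin p) = 0"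
  using excess_Ask_Ret[of d orc "[]" "\<lambda>_ x. x" "\<lambda>_. p"] by (simp add: coin_def)

lemma cost_coin [simp]: "cost orc (coin p) = 0"
  using cost_Ask_Ret[of orc "[]" "\<lambda>_ x. x" "\<lambda>_. p"] by (simp add: coin_def)

primrec parl :: "'a prog list \<Rightarrow> 'a list prog" where
  "parl [] = Ret []"
| "parl (A # As) = mapp (\<lambda>(x, xs). x # xs) (par A (parl As))"

lemma cost_parl: "cost orc (parl As) = (\<Sum>A\<leftarrow>As. cost orc A)"
  by (induction As) auto

lemma excess_parl: "(\<And>A. A \<in> set As \<Longrightarrow> excess orc d A = 0) \<Longrightarrow> excess orc d (parl As) = 0"
proof (induction As)
  case (Cons A As)
  then show ?case using excess_par[of orc d A "parl As"] by simp
qed simp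

lemma law_parl_return:
  "(\<And>y. y \<in> set ys \<Longrightarrow> law orc (f y) = return_pmf (g y)) \<Longrightarrow>
    law orc (parl (map f ys)) = return_pmf (map g ys)"
  by (induction ys) (auto simp: bind_return_pmf)

text \<open>Among several successes the one at the smallest position is kept, not the one that
  finishes first; this avoids a bias towards fast runs.\<close>

primrec first_of :: "nat \<Rightarrow> 'a option prog \<Rightarrow> 'a option prog" where
  "first_of 0 A = Ret None"
| "first_of (Suc k) A =
     mapp (\<lambda>(x, y). case x of None \<Rightarrow> y | Some z \<Rightarrow> Some z) (par A (first_of k A))"

lemma cost_first_of: "cost orc (first_of k A) = of_nat k * cost orc A"
  by (induction k) (auto simp: algebra_simps)

lemma excess_first_of: "excess orc d (first_of k A) \<le> of_nat k * excess orc d A"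
proof (induction k)
  case (Suc k)
  have "excess orc d (first_of (Suc k) A) \<le> excess orc d A + excess orc d (first_of k A)"
    using excess_par[of orc d A "first_of k A"] by simp
  also have "\<dots> \<le> excess orc d A + of_nat k * excess orc d A"
    using Suc by (intro add_left_mono)
  finally show ?case by (simp add: algebra_simps)
qed simp

text \<open>\<open>f\<close> bounds the number of batches left, \<open>s\<close> counts the attempts
  made so far. The batch size \<open>Suc (s div L)\<close> lets \<open>s\<close> grow by a factor of
  about \<open>1 + 1 / L\<close>; when \<open>f\<close> runs out, \<open>F\<close> takes
  over.\<close>

primrec retry :: "nat \<Rightarrow> 'a option prog \<Rightarrow> 'a prog \<Rightarrow> nat \<Rightarrow> nat \<Rightarrow> 'a prog" where
  "retry L A F 0 s = F"
| "retry L A F (Suc f) s = bindp (first_of (Suc (s div L)) A) (\<lambda>x.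
     case x of None \<Rightarrow> retry L A F f (s + Suc (s div L)) | Some y \<Rightarrow> Ret y)"

text \<open>This and the next two functions evaluate \<open>retry\<close> from the state
  \<open>f\<close>, \<open>s\<close> when an attempt fails with probability \<open>p\<close>: the
  expected numbers of batches and of attempts, and the probability of reaching \<open>F\<close>. The
  base value \<open>1\<close> counts \<open>F\<close> as a batch.\<close>

primrec batches :: "real \<Rightarrow> nat \<Rightarrow> nat \<Rightarrow> nat \<Rightarrow> real" where
  "batches p L 0 s = 1"
| "batches p L (Suc f) s = 1 + p ^ Suc (s div L) * batches p L f (s + Suc (s div L))"

primrec attempts :: "real \<Rightarrow> nat \<Rightarrow> nat \<Rightarrow> nat \<Rightarrow> real" where
  "attempts p L 0 s = 0"
| "attempts p L (Suc f) s =
    real (Suc (s div L)) + p ^ Suc (s div L) * attempts p L f (s + Suc (s div L))"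

primrec exhausted :: "real \<Rightarrow> nat \<Rightarrow> nat \<Rightarrow> nat \<Rightarrow> real" where
  "exhausted p L 0 s = 1"
| "exhausted p L (Suc f) s = p ^ Suc (s div L) * exhausted p L f (s + Suc (s div L))"

section \<open>Estimates for growing batches\<close>

lemma batches_nonneg: "0 \<le> p \<Longrightarrow> 0 \<le> batches p L f s"
  by (induction f arbitrary: s) auto

lemma attempts_nonneg: "0 \<le> p \<Longrightarrow> 0 \<le> attempts p L f s"
  by (induction f arbitrary: s) auto

lemma exhausted_nonneg: "0 \<le> p \<Longrightarrow> 0 \<le> exhausted p L f s"
  by (induction f arbitrary: s) auto

text \<open>\<open>(s + 1) * (1 - t) ^ s\<close> is at most the geometric sum of the powers up to
  \<open>s\<close>, and \<open>t\<close> times this sum telescopes to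
  \<open>1 - (1 - t) ^ Suc s\<close>.\<close>

lemma power_times_complement_le:
  fixes t :: real
  assumes "0 < t" "t \<le> 1"
  shows "t * (1 - t) ^ s \<le> 1 / (real s + 1)"
proof -
  have "real (Suc s) * (1 - t) ^ s = (\<Sum>i\<le>s. (1 - t) ^ s)" by simp
  also have "\<dots> \<le> (\<Sum>i\<le>s. (1 - t) ^ i)"
    using assms by (intro sum_mono power_decreasing) auto
  finally have "t * (real (Suc s) * (1 - t) ^ s) \<le> t * (\<Sum>i\<le>s. (1 - t) ^ i)"
    using assms by (intro mult_left_mono) auto
  also have "\<dots> = 1 - (1 - t) ^ Suc s"
    using one_diff_power_eq[of "1 - t" "Suc s"] by (simp add: lessThan_Suc_atMost)
  also have "\<dots> \<le> 1" using assms by simp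
  finally show ?thesis by (simp add: field_simps)
qed

text \<open>A batch contains at least one attempt, so exhaustion means at least \<open>s + f\<close>
  failures in all. The decay in \<open>f\<close> will cancel the cost of the fallback.\<close>

lemma exhausted_le:
  assumes "0 < t" "t \<le> 1"
  shows "t * (1 - t) ^ s * exhausted (1 - t) L f s \<le> 1 / (real s + real f + 1)"
proof (induction f arbitrary: s)
  case 0
  show ?case using power_times_complement_le[OF assms] by simp
next
  case (Suc f)
  let ?k = "Suc (s div L)"
  have "t * (1 - t) ^ s * exhausted (1 - t) L (Suc f) s
      = t * (1 - t) ^ (s + ?k) * exhausted (1 - t) L f (s + ?k)"
    by (simp add: power_add mult_ac)
  also have "\<dots> \<le> 1 / (real (s + ?k) + real f + 1)" by (rule Suc)
  also have "\<dots> \<le> 1 / (real s + real (Suc f) + 1)" by (intro divide_left_mono) auto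
  finally show ?case .
qed

lemma batch_size_bounds:
  assumes "0 < L"
  shows "(real s + 1) / real L \<le> real (Suc (s div L))" "real (s div L) \<le> real s / real L"
proof -
  have "s + 1 \<le> L * Suc (s div L)"
    using assms by (metis Suc_leI add.commute mult.commute mult_Suc dividend_less_div_times
        plus_1_eq_Suc mult_Suc_right)
  then have "real (s + 1) \<le> real (L * Suc (s div L))" by (rule of_nat_mono)
  then show "(real s + 1) / real L \<le> real (Suc (s div L))"
    using assms by (simp add: field_simps)
  show "real (s div L) \<le> real s / real L" by (rule of_nat_div_le_of_nat)
qed

text \<open>Each of the first \<open>J\<close> batches is charged \<open>t\<close>. During them
  \<open>s + 1\<close> grows by the factor \<open>(1 + 1 / L) ^ J\<close>, and from then on the
  bound \<open>t * (1 - t) ^ s \<le> 1 / (s + 1)\<close> decays geometrically. \<open>J\<close>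
  remains free, to be chosen at the end.\<close>

lemma batches_le:
  assumes t: "0 < t" "t \<le> 1" and L: "0 < L"
  shows "t * (1 - t) ^ s * batches (1 - t) L f s
    \<le> real J * t + (real L + 1) / ((real s + 1) * (1 + 1 / real L) ^ J)"
proof (induction f arbitrary: s J)
  case 0
  show ?case
  proof (cases J)
    case 0
    have "t * (1 - t) ^ s \<le> 1 / (real s + 1)" by (rule power_times_complement_le[OF t])
    also have "\<dots> \<le> (real L + 1) / (real s + 1)" by (intro divide_right_mono) auto
    finally show ?thesis using 0 by simp
  next
    case (Suc J')
    have "t * (1 - t) ^ s \<le> t * 1" using t by (intro mult_left_mono power_le_one) auto
    also have "\<dots> \<le> real J * t" using t Suc by (simp add: field_simps)
    finally show ?thesis using L by (simp add: add_increasing2)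
  qed
next
  case (Suc f)
  let ?k = "Suc (s div L)"
  have eq: "t * (1 - t) ^ s * batches (1 - t) L (Suc f) s
      = t * (1 - t) ^ s + t * (1 - t) ^ (s + ?k) * batches (1 - t) L f (s + ?k)"
    by (simp add: power_add algebra_simps)
  have k: "(real s + 1) * (1 + 1 / real L) \<le> real (s + ?k) + 1"
    using batch_size_bounds(1)[OF L, of s] L by (simp add: field_simps)
  have step: "(real L + 1) / ((real (s + ?k) + 1) * (1 + 1 / real L) ^ j)
    \<le> (real L + 1) / ((real s + 1) * (1 + 1 / real L) ^ Suc j)" for j
  proof -
    have "(real s + 1) * (1 + 1 / real L) * (1 + 1 / real L) ^ j
        \<le> (real (s + ?k) + 1) * (1 + 1 / real L) ^ j"
      using L by (intro mult_right_mono k) auto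
    then show ?thesis
      using L by (intro divide_left_mono mult_pos_pos zero_less_power)
        (auto simp: mult.assoc add_pos_nonneg)
  qed
  show ?case
  proof (cases J)
    case 0
    have "t * (1 - t) ^ s + t * (1 - t) ^ (s + ?k) * batches (1 - t) L f (s + ?k)
       \<le> 1 / (real s + 1) + (real L + 1) / ((real s + 1) * (1 + 1 / real L))"
      using power_times_complement_le[OF t, of s] Suc.IH[of "s + ?k" 0] step[of 0] by simp
    \<comment> \<open>\<open>L + 1\<close> is the value of the geometric series with ratio
      \<open>L / (L + 1)\<close>, so the first term and the rest add up exactly.\<close>
    also have "(real L + 1) / ((real s + 1) * (1 + 1 / real L)) = real L / (real s + 1)"
      using L by (simp add: divide_simps add_pos_nonneg)
    also have "1 / (real s + 1) + real L / (real s + 1) = (real L + 1) / (real s + 1)"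
      by (simp add: add_divide_distrib)
    finally show ?thesis unfolding eq using 0 by simp
  next
    case (Suc J')
    have "t * (1 - t) ^ s \<le> t * 1" using t by (intro mult_left_mono power_le_one) auto
    then show ?thesis
      unfolding eq Suc using Suc.IH[of "s + ?k" J'] step[of J'] by (simp add: algebra_simps)
  qed
qed

text \<open>Purely sequential attempts would need \<open>1 / t\<close> in expectation. A batch of
  size \<open>k\<close> wastes attempts only if it succeeds, and at most
  \<open>k - 1 \<le> s / L\<close> of them, a fraction \<open>1 / L\<close> of those already made.
  The term \<open>s / L\<close> makes the bound inductive.\<close>

lemma attempts_le:
  assumes t: "0 < t" "t \<le> 1" and L: "0 < L"
  shows "attempts (1 - t) L f s \<le> (1 + 1 / real L) / t + real s / real L"
proof (induction f arbitrary: s)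
  case 0
  show ?case using t by simp
next
  case (Suc f)
  define k where "k = Suc (s div L)"
  define p where "p = 1 - t"
  define e where "e = 1 / real L"
  define g where "g = (\<Sum>i<k. p ^ i)"
  have p: "0 \<le> p" "p \<le> 1" and e: "0 \<le> e" and g0: "0 \<le> g"
    using t by (auto simp: p_def e_def g_def intro!: sum_nonneg)
  have tg: "t * g = 1 - p ^ k"
    using one_diff_power_eq[of p k] by (simp add: g_def p_def)
  have k: "real k - 1 \<le> e * real s"
    using batch_size_bounds(2)[OF L, of s] by (simp add: k_def e_def)
  \<comment> \<open>\<open>g\<close> is the expected number of attempts up to the first success, cut
    off at \<open>k\<close>, so \<open>k - g\<close> is the waste; \<open>t * g\<close> is the
    probability that the batch succeeds.\<close>
  have kg: "real k - g \<le> t * ((real k - 1) * g)"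
  proof -
    have "real k - g = (\<Sum>i<k. 1 - p ^ i)" by (simp add: g_def sum_subtractf)
    also have "\<dots> = (\<Sum>i<k. t * (\<Sum>j<i. p ^ j))"
      using one_diff_power_eq[of p] by (simp add: p_def)
    also have "\<dots> \<le> (\<Sum>i\<in>{1..<k}. t * g)"
    proof -
      have "(\<Sum>i<k. t * (\<Sum>j<i. p ^ j)) = (\<Sum>i\<in>{1..<k}. t * (\<Sum>j<i. p ^ j))"
        by (rule sum.mono_neutral_right) (auto simp: not_le)
      also have "\<dots> \<le> (\<Sum>i\<in>{1..<k}. t * g)"
        unfolding g_def using t p by (intro sum_mono mult_left_mono sum_mono2) auto
      finally show ?thesis .
    qed
    also have "\<dots> = t * ((real k - 1) * g)" by (simp add: k_def)
    finally show ?thesis .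
  qed
  have pk: "real k * p ^ k \<le> g"
  proof -
    have "real k * p ^ k = (\<Sum>i<k. p ^ k)" by simp
    also have "\<dots> \<le> g" unfolding g_def using p by (intro sum_mono power_decreasing) auto
    finally show ?thesis .
  qed
  define c where "c = (1 + e) / t"
  have "attempts (1 - t) L (Suc f) s = real k + p ^ k * attempts p L f (s + k)"
    by (simp add: k_def p_def)
  also have "\<dots> \<le> real k + p ^ k * (c + e * (real s + real k))"
    using Suc[of "s + k"] p by (intro add_left_mono mult_left_mono) (auto simp: c_def e_def p_def algebra_simps add_divide_distrib)
  also have "\<dots> = c + e * real s + (real k + e * (real k * p ^ k)
      - (1 - p ^ k) * c - e * real s * (1 - p ^ k))"
    by (simp add: algebra_simps)
  also have "(1 - p ^ k) * c = (1 + e) * g"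
    using t by (simp add: tg[symmetric] c_def)
  also have "real k + e * (real k * p ^ k) - (1 + e) * g - e * real s * (1 - p ^ k) \<le> 0"
  proof -
    have "e * (real k * p ^ k) \<le> e * g" using e pk by (rule mult_left_mono[rotated])
    moreover have "t * ((real k - 1) * g) \<le> e * real s * (1 - p ^ k)"
      unfolding tg[symmetric] using mult_right_mono[OF k, of "t * g"] t g0 by (simp add: mult_ac)
    ultimately show ?thesis using kg by (simp add: algebra_simps)
  qed
  finally show ?case by (simp add: e_def c_def)
qed

section \<open>Law and cost of repeated attempts\<close>

definition mixture :: "real \<Rightarrow> 'a pmf \<Rightarrow> 'a option pmf" where
  "mixture t \<rho> = bind_pmf (bernoulli_pmf t) (\<lambda>b. if b then map_pmf Some \<rho> else return_pmf None)"

text \<open>Given success, the delivered sample has law \<open>\<rho>\<close> whatever the number of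
  failures before it. So completing a batch by a fresh sample of \<open>\<rho>\<close> upon total
  failure introduces no bias.\<close>

lemma law_first_of_bind:
  assumes "law orc A = mixture t \<rho>"
  shows "bind_pmf (law orc (first_of k A)) (\<lambda>x. case x of None \<Rightarrow> \<rho> | Some y \<Rightarrow> return_pmf y) = \<rho>"
proof (induction k)
  case 0
  show ?case by (simp add: bind_return_pmf)
next
  case (Suc k)
  have "bind_pmf (law orc (first_of (Suc k) A)) (\<lambda>x. case x of None \<Rightarrow> \<rho> | Some y \<Rightarrow> return_pmf y)
    = bind_pmf (mixture t \<rho>) (\<lambda>x. bind_pmf (law orc (first_of k A)) (\<lambda>y.
       case (case x of None \<Rightarrow> y | Some z \<Rightarrow> Some z) of None \<Rightarrow> \<rho> | Some y \<Rightarrow> return_pmf y))"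
    by (simp add: assms pair_pmf_def bind_assoc_pmf bind_return_pmf)
  also have "\<dots> = bind_pmf (mixture t \<rho>) (\<lambda>x. case x of None \<Rightarrow> \<rho> | Some z \<Rightarrow> return_pmf z)"
    by (intro bind_pmf_cong refl) (auto split: option.splits simp: Suc)
  also have "\<dots> = bind_pmf (bernoulli_pmf t) (\<lambda>b. \<rho>)"
    unfolding mixture_def bind_assoc_pmf
    by (intro bind_pmf_cong refl) (auto simp: bind_map_pmf bind_return_pmf bind_return_pmf')
  finally show ?case by simp
qed

lemma law_first_of_None:
  assumes "law orc A = mixture t \<rho>" "0 \<le> t" "t \<le> 1"
  shows "pmf (law orc (first_of k A)) None = (1 - t) ^ k"
proof (induction k)
  case (Suc k)
  have *: "measure_pmf.expectation (law orc (first_of k A))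
      (\<lambda>y. indicat_real {None} (case x of None \<Rightarrow> y | Some z \<Rightarrow> Some z))
    = (1 - t) ^ k * indicat_real {None} x" for x
    by (cases x) (auto simp: Suc measure_pmf_single)
  have "pmf (law orc (first_of (Suc k) A)) None = (\<integral>x. (\<integral>y.
       indicator {None} (case x of None \<Rightarrow> y | Some z \<Rightarrow> Some z) \<partial>law orc (first_of k A)) \<partial>mixture t \<rho>)"
    by (simp add: assms pair_pmf_def bind_assoc_pmf bind_return_pmf pmf_bind)
  also have "\<dots> = (\<integral>x. (1 - t) ^ k * indicator {None} x \<partial>mixture t \<rho>)"
    unfolding * ..
  also have "\<dots> = (1 - t) ^ k * pmf (mixture t \<rho>) None"
    by (simp add: measure_pmf_single)
  also have "pmf (mixture t \<rho>) None = 1 - t"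
    using assms by (simp add: mixture_def pmf_bind pmf_map_outside)
  finally show ?case by simp
qed simp

lemma law_retry:
  assumes "law orc A = mixture t \<rho>" "law orc F = \<rho>"
  shows "law orc (retry L A F f s) = \<rho>"
proof (induction f arbitrary: s)
  case (Suc f)
  have "law orc (retry L A F (Suc f) s) = bind_pmf (law orc (first_of (Suc (s div L)) A))
      (\<lambda>x. case x of None \<Rightarrow> \<rho> | Some y \<Rightarrow> return_pmf y)"
    unfolding retry.simps law_bindp
    using Suc by (intro bind_pmf_cong refl) (auto split: option.splits)
  then show ?case using law_first_of_bind[OF assms(1)] by (simp only:)
qed (use assms in simp)

lemma nn_integral_None:
  "(\<integral>\<^sup>+x. (case x of None \<Rightarrow> c | Some y \<Rightarrow> 0) \<partial>measure_pmf M) = ennreal (pmf M None) * c"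
proof -
  have "(\<integral>\<^sup>+x. (case x of None \<Rightarrow> c | Some y \<Rightarrow> 0) \<partial>measure_pmf M) = (\<integral>\<^sup>+x. c * indicator {None} x \<partial>M)"
    by (intro nn_integral_cong) (auto split: option.splits)
  then show ?thesis by (simp add: nn_integral_cmult_indicator emeasure_pmf_single mult.commute)
qed

text \<open>The allowance \<open>d\<close> is charged once per batch and the excess once per
  attempt; \<open>F\<close> fits into \<open>d\<close> and is paid as the last batch.\<close>

lemma retry_bound:
  assumes A: "law orc A = mixture t \<rho>" "0 \<le> t" "t \<le> 1"
    and F: "excess orc d F = 0"
  shows "cost orc (retry L A F f s)
      \<le> ennreal (attempts (1 - t) L f s) * cost orc A + ennreal (exhausted (1 - t) L f s) * cost orc F"
    and "excess orc 0 (retry L A F f s)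
      \<le> ennreal (batches (1 - t) L f s) * of_nat d + ennreal (attempts (1 - t) L f s) * excess orc d A"
proof -
  have "cost orc (retry L A F f s)
      \<le> ennreal (attempts (1 - t) L f s) * cost orc A + ennreal (exhausted (1 - t) L f s) * cost orc F \<and>
    excess orc 0 (retry L A F f s)
      \<le> ennreal (batches (1 - t) L f s) * of_nat d + ennreal (attempts (1 - t) L f s) * excess orc d A"
  proof (induction f arbitrary: s)
    case 0
    show ?case using excess_0_le[of orc F d] F by simp
  next
    case (Suc f)
    define k where "k = Suc (s div L)"
    define p where "p = 1 - t"
    let ?B = "retry L A F f (s + k)"
    have p: "0 \<le> p" using A by (simp add: p_def)
    have k: "(of_nat k :: ennreal) = ennreal (real k)" by (simp add: ennreal_of_nat_eq_real_of_nat)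
    have eq: "retry L A F (Suc f) s = bindp (first_of k A) (\<lambda>x. case x of None \<Rightarrow> ?B | Some y \<Rightarrow> Ret y)"
      by (simp only: k_def retry.simps)
    have None: "pmf (law orc (first_of k A)) None = p ^ k"
      using law_first_of_None[OF A] by (simp add: p_def)
    have att: "ennreal (attempts p L (Suc f) s)
        = ennreal (real k) + ennreal (p ^ k) * ennreal (attempts p L f (s + k))"
      using p attempts_nonneg[OF p, of L f "s + k"] by (simp add: k_def ennreal_plus ennreal_mult'' del: of_nat_Suc)
    have bat: "ennreal (batches p L (Suc f) s) = 1 + ennreal (p ^ k) * ennreal (batches p L f (s + k))"
      using p batches_nonneg[OF p, of L f "s + k"] by (simp add: k_def ennreal_plus ennreal_mult'' del: of_nat_Suc)
    have exh: "ennreal (exhausted p L (Suc f) s) = ennreal (p ^ k) * ennreal (exhausted p L f (s + k))"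
      using p exhausted_nonneg[OF p, of L f "s + k"] by (simp add: k_def ennreal_mult'' del: of_nat_Suc)
    have 1: "cost orc (retry L A F (Suc f) s) \<le> ennreal (attempts p L (Suc f) s) * cost orc A + ennreal (exhausted p L (Suc f) s) * cost orc F"
    proof -
      have "cost orc (retry L A F (Suc f) s) = of_nat k * cost orc A +
         (\<integral>\<^sup>+x. (case x of None \<Rightarrow> cost orc ?B | Some y \<Rightarrow> 0) \<partial>law orc (first_of k A))"
        unfolding eq cost_bindp cost_first_of
        by (intro arg_cong2[where f = "(+)"] nn_integral_cong refl) (auto split: option.splits)
      also have "\<dots> = of_nat k * cost orc A + ennreal (p ^ k) * cost orc ?B"
        by (simp add: nn_integral_None None)
      also have "\<dots> \<le> of_nat k * cost orc A + ennreal (p ^ k) *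
          (ennreal (attempts p L f (s + k)) * cost orc A + ennreal (exhausted p L f (s + k)) * cost orc F)"
        unfolding p_def by (intro add_left_mono mult_left_mono Suc[THEN conjunct1]) simp
      finally show ?thesis
        unfolding att exh k by (simp add: algebra_simps)
    qed
    have 2: "excess orc 0 (retry L A F (Suc f) s)
        \<le> ennreal (batches p L (Suc f) s) * of_nat d + ennreal (attempts p L (Suc f) s) * excess orc d A"
    proof -
      have "excess orc 0 (retry L A F (Suc f) s) \<le> excess orc 0 (first_of k A) +
         (\<integral>\<^sup>+x. (case x of None \<Rightarrow> excess orc 0 ?B | Some y \<Rightarrow> 0) \<partial>law orc (first_of k A))"
        unfolding eq
        by (rule order_trans[OF excess_bindp[of orc 0 0, simplified]])
          (auto intro!: nn_integral_mono split: option.splits)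
      also have "\<dots> = excess orc 0 (first_of k A) + ennreal (p ^ k) * excess orc 0 ?B"
        by (simp add: nn_integral_None None)
      also have "\<dots> \<le> (of_nat d + of_nat k * excess orc d A) + ennreal (p ^ k) *
          (ennreal (batches p L f (s + k)) * of_nat d + ennreal (attempts p L f (s + k)) * excess orc d A)"
        unfolding p_def
        by (intro add_mono mult_left_mono Suc[THEN conjunct2] order_trans[OF excess_0_le[of orc _ d]] excess_first_of) simp_all
      finally show ?thesis
        unfolding att bat k by (simp add: algebra_simps)
    qed
    show ?case using 1 2 by (simp only: p_def)
  qed
  then show "cost orc (retry L A F f s)
      \<le> ennreal (attempts (1 - t) L f s) * cost orc A + ennreal (exhausted (1 - t) L f s) * cost orc F"
    and "excess orc 0 (retry L A F f s)
      \<le> ennreal (batches (1 - t) L f s) * of_nat d + ennreal (attempts (1 - t) L f s) * excess orc d A"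
    by auto
qed

text \<open>Retrying starts only after a rejection, which has probability \<open>t\<close>. This
  weight turns the roughly \<open>1 / t\<close> expected attempts into \<open>1 + 1 / L\<close>, so
  that \<open>A\<close> is called about once in expectation.\<close>

lemma retry_bound_rejected:
  assumes A: "law orc A = mixture t \<rho>" "0 < t" "t \<le> 1" and F: "excess orc d F = 0" and L: "0 < L"
  shows "ennreal t * cost orc (retry L A F f 0)
      \<le> ennreal (1 + 1 / real L) * cost orc A + ennreal (1 / (real f + 1)) * cost orc F"
    and "ennreal t * excess orc 0 (retry L A F f 0)
      \<le> ennreal (real d * (real J * t + (real L + 1) / (1 + 1 / real L) ^ J))
        + ennreal (1 + 1 / real L) * excess orc d A"
proof -
  have 1: "t * attempts (1 - t) L f 0 \<le> 1 + 1 / real L"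
    using attempts_le[OF A(2,3) L, of f 0] A(2) by (simp add: pos_le_divide_eq mult.commute)
  have 2: "t * exhausted (1 - t) L f 0 \<le> 1 / (real f + 1)"
    using exhausted_le[OF A(2,3), of 0 L f] by simp
  have 3: "t * batches (1 - t) L f 0 \<le> real J * t + (real L + 1) / (1 + 1 / real L) ^ J"
    using batches_le[OF A(2,3) L, of 0 f J] by simp
  have t: "0 \<le> t" "0 \<le> 1 - t" using A by auto
  note nn = attempts_nonneg[OF t(2)] batches_nonneg[OF t(2)] exhausted_nonneg[OF t(2)]
  have "ennreal t * cost orc (retry L A F f 0)
     \<le> ennreal t * (ennreal (attempts (1 - t) L f 0) * cost orc A + ennreal (exhausted (1 - t) L f 0) * cost orc F)"
    by (intro mult_left_mono retry_bound(1)[OF A(1) t(1) A(3) F]) simp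
  also have "\<dots> = ennreal (t * attempts (1 - t) L f 0) * cost orc A + ennreal (t * exhausted (1 - t) L f 0) * cost orc F"
    using t nn by (simp add: ennreal_mult algebra_simps)
  also have "\<dots> \<le> ennreal (1 + 1 / real L) * cost orc A + ennreal (1 / (real f + 1)) * cost orc F"
    by (intro add_mono mult_right_mono ennreal_leI 1 2) simp_all
  finally show "ennreal t * cost orc (retry L A F f 0)
      \<le> ennreal (1 + 1 / real L) * cost orc A + ennreal (1 / (real f + 1)) * cost orc F" .
  have "ennreal t * excess orc 0 (retry L A F f 0)
     \<le> ennreal t * (ennreal (batches (1 - t) L f 0) * of_nat d + ennreal (attempts (1 - t) L f 0) * excess orc d A)"
    by (intro mult_left_mono retry_bound(2)[OF A(1) t(1) A(3) F]) simp
  also have "\<dots> = ennreal (real d * (t * batches (1 - t) L f 0)) + ennreal (t * attempts (1 - t) L f 0) * excess orc d A"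
    using t nn by (simp add: ennreal_mult ennreal_of_nat_eq_real_of_nat algebra_simps)
  also have "\<dots> \<le> ennreal (real d * (real J * t + (real L + 1) / (1 + 1 / real L) ^ J))
        + ennreal (1 + 1 / real L) * excess orc d A"
    by (intro add_mono mult_right_mono mult_left_mono ennreal_leI 1 3) simp_all
  finally show "ennreal t * excess orc 0 (retry L A F f 0)
      \<le> ennreal (real d * (real J * t + (real L + 1) / (1 + 1 / real L) ^ J))
        + ennreal (1 + 1 / real L) * excess orc d A" .
qed

section \<open>Speculative rejection sampling\<close>

text \<open>The total variation distance, written as an expectation under \<open>\<mu>\<close>: only
  the support of \<open>\<mu>\<close> matters, and the entropy bound can be proved
  pointwise.\<close>

definition rejection :: "'a pmf \<Rightarrow> 'a pmf \<Rightarrow> real" where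
  "rejection \<mu> \<nu> = measure_pmf.expectation \<mu> (\<lambda>y. max 0 (1 - pmf \<nu> y / pmf \<mu> y))"

lemma rejection_nonneg: "0 \<le> rejection \<mu> \<nu>"
  unfolding rejection_def by (intro integral_nonneg_AE) auto

lemma expectation_pmf_finite:
  fixes f :: "'a \<Rightarrow> real"
  assumes "finite Y" "set_pmf M \<subseteq> Y"
  shows "measure_pmf.expectation M f = (\<Sum>y\<in>Y. pmf M y * f y)"
  using assms by (subst integral_measure_pmf[of Y]) auto

lemma nn_integral_pmf_finite:
  assumes "finite (set_pmf M)" "\<And>y. y \<in> set_pmf M \<Longrightarrow> 0 \<le> f y"
  shows "(\<integral>\<^sup>+y. ennreal (f y) \<partial>measure_pmf M) = ennreal (measure_pmf.expectation M f)"
  using assms by (intro nn_integral_eq_integral integrable_measure_pmf_finite AE_pmfI) auto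

context
  fixes \<mu> \<nu> :: "'a pmf" and Y :: "'a set"
  assumes Y: "finite Y" "set_pmf \<mu> \<subseteq> Y" "set_pmf \<nu> \<subseteq> Y"
begin

lemma rejection_eq: "rejection \<mu> \<nu> = (\<Sum>y\<in>Y. max 0 (pmf \<mu> y - pmf \<nu> y))"
  unfolding rejection_def expectation_pmf_finite[OF Y(1,2)]
proof (intro sum.cong refl)
  fix y
  show "pmf \<mu> y * max 0 (1 - pmf \<nu> y / pmf \<mu> y) = max 0 (pmf \<mu> y - pmf \<nu> y)"
  proof (cases "pmf \<mu> y = 0")
    case False
    then have "0 < pmf \<mu> y" by simp
    then show ?thesis by (auto simp: max_def field_simps)
  qed auto
qed

lemma rejection_le_1: "rejection \<mu> \<nu> \<le> 1"
proof -
  have "rejection \<mu> \<nu> \<le> (\<Sum>y\<in>Y. pmf \<mu> y)"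
    unfolding rejection_eq by (intro sum_mono) auto
  then show ?thesis using sum_pmf_eq_1[OF Y(1,2)] by simp
qed

text \<open>The sum is the probability of rejecting a draft from \<open>\<nu>\<close>. It equals the
  total positive part of \<open>\<mu> - \<nu>\<close> because both distributions have mass
  one.\<close>

lemma rejection_eq': "rejection \<mu> \<nu> = (\<Sum>y\<in>Y. pmf \<nu> y * (1 - min 1 (pmf \<mu> y / pmf \<nu> y)))"
proof -
  have "(\<Sum>y\<in>Y. pmf \<nu> y * (1 - min 1 (pmf \<mu> y / pmf \<nu> y)))
      = (\<Sum>y\<in>Y. max 0 (pmf \<mu> y - pmf \<nu> y) + (pmf \<nu> y - pmf \<mu> y))"
  proof (intro sum.cong refl)
    fix y
    show "pmf \<nu> y * (1 - min 1 (pmf \<mu> y / pmf \<nu> y)) = max 0 (pmf \<mu> y - pmf \<nu> y) + (pmf \<nu> y - pmf \<mu> y)"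
    proof (cases "pmf \<nu> y = 0")
      case False
      then have "0 < pmf \<nu> y" by simp
      then show ?thesis by (auto simp: max_def min_def field_simps)
    qed auto
  qed
  also have "\<dots> = rejection \<mu> \<nu>"
    using sum_pmf_eq_1[OF Y(1,2)] sum_pmf_eq_1[OF Y(1,3)]
    by (simp add: rejection_eq sum.distrib sum_subtractf)
  finally show ?thesis by simp
qed

text \<open>Accepted drafts contribute \<open>min (\<nu> z) (\<mu> z)\<close>, rejected ones the
  missing positive part of \<open>\<mu> z - \<nu> z\<close>. The assumption is stated without
  division, so that a vanishing rejection probability leaves \<open>\<rho>\<close>
  arbitrary.\<close>

lemma speculation_correct:
  assumes "\<And>z. rejection \<mu> \<nu> * pmf \<rho> z = max 0 (pmf \<mu> z - pmf \<nu> z)"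
  shows "bind_pmf \<nu> (\<lambda>y. bind_pmf (bernoulli_pmf (min 1 (pmf \<mu> y / pmf \<nu> y)))
    (\<lambda>b. if b then return_pmf y else \<rho>)) = \<mu>"
proof (rule pmf_eqI)
  fix z
  let ?a = "\<lambda>y. min 1 (pmf \<mu> y / pmf \<nu> y)"
  have b: "pmf (bind_pmf (bernoulli_pmf (?a y)) (\<lambda>b. if b then return_pmf y else \<rho>)) z
     = ?a y * indicator {z} y + (1 - ?a y) * pmf \<rho> z" for y
    by (simp add: pmf_bind)
  have "pmf (bind_pmf \<nu> (\<lambda>y. bind_pmf (bernoulli_pmf (?a y)) (\<lambda>b. if b then return_pmf y else \<rho>))) z
    = (\<Sum>y\<in>Y. pmf \<nu> y * (?a y * indicator {z} y + (1 - ?a y) * pmf \<rho> z))"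
    by (subst pmf_bind) (simp only: b expectation_pmf_finite[OF Y(1,3)])
  also have "\<dots> = (\<Sum>y\<in>Y. (pmf \<nu> y * ?a y) * indicator {z} y) + (\<Sum>y\<in>Y. pmf \<nu> y * (1 - ?a y)) * pmf \<rho> z"
    unfolding sum_distrib_right sum.distrib[symmetric] by (intro sum.cong refl) (simp add: algebra_simps)
  also have "(\<Sum>y\<in>Y. pmf \<nu> y * (1 - ?a y)) * pmf \<rho> z = max 0 (pmf \<mu> z - pmf \<nu> z)"
    by (simp add: rejection_eq'[symmetric] assms)
  also have "(\<Sum>y\<in>Y. (pmf \<nu> y * ?a y) * indicator {z} y) = pmf \<nu> z * ?a z"
  proof (cases "z \<in> Y")
    case True
    then show ?thesis using Y(1) by (simp add: indicator_def)
  next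
    case False
    then have "pmf \<nu> z = 0" using Y(3) by (auto simp: set_pmf_iff)
    then show ?thesis using False by (auto simp: indicator_def intro!: sum.neutral)
  qed
  also have "pmf \<nu> z * ?a z = min (pmf \<nu> z) (pmf \<mu> z)"
  proof (cases "pmf \<nu> z = 0")
    case False
    then have "0 < pmf \<nu> z" by simp
    then show ?thesis by (auto simp: min_def field_simps)
  qed auto
  finally show "pmf (bind_pmf \<nu> (\<lambda>y. bind_pmf (bernoulli_pmf (?a y)) (\<lambda>b. if b then return_pmf y else \<rho>))) z
     = pmf \<mu> z" by simp
qed

text \<open>Thinning a sample of \<open>\<mu>\<close> by this probability keeps the mass
  \<open>max 0 (\<mu> z - \<nu> z)\<close>. Its total is the rejection probability: an attempt
  succeeds exactly as often as attempts are needed.\<close>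

lemma attempt_mixture:
  assumes "\<And>z. rejection \<mu> \<nu> * pmf \<rho> z = max 0 (pmf \<mu> z - pmf \<nu> z)"
  shows "bind_pmf \<mu> (\<lambda>y. map_pmf (\<lambda>b. if b then Some y else None)
    (bernoulli_pmf (max 0 (1 - pmf \<nu> y / pmf \<mu> y)))) = mixture (rejection \<mu> \<nu>) \<rho>"
proof (rule pmf_eqI)
  fix z
  let ?t = "rejection \<mu> \<nu>"
  let ?a = "\<lambda>y. max 0 (1 - pmf \<nu> y / pmf \<mu> y)"
  have a: "0 \<le> ?a y" "?a y \<le> 1" for y by (auto simp: divide_simps)
  have b: "pmf (map_pmf (\<lambda>b. if b then Some y else None) (bernoulli_pmf (?a y))) z
     = ?a y * indicator {z} (Some y) + (1 - ?a y) * indicator {z} None" for y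
    using a[of y] by (simp add: map_pmf_def pmf_bind)
  have "pmf (bind_pmf \<mu> (\<lambda>y. map_pmf (\<lambda>b. if b then Some y else None) (bernoulli_pmf (?a y)))) z
    = (\<Sum>y\<in>Y. pmf \<mu> y * (?a y * indicator {z} (Some y) + (1 - ?a y) * indicator {z} None))"
    by (subst pmf_bind) (simp only: b expectation_pmf_finite[OF Y(1,2)])
  also have "\<dots> = pmf (mixture ?t \<rho>) z"
  proof (cases z)
    case None
    have "(\<Sum>y\<in>Y. pmf \<mu> y * (1 - ?a y)) = 1 - ?t"
      using sum_pmf_eq_1[OF Y(1,2)]
      by (simp add: rejection_def expectation_pmf_finite[OF Y(1,2)] right_diff_distrib sum_subtractf)
    then show ?thesis
      using None rejection_nonneg[of \<mu> \<nu>] rejection_le_1 by (simp add: mixture_def pmf_bind pmf_map_outside)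
  next
    case (Some x)
    have "(\<Sum>y\<in>Y. pmf \<mu> y * (?a y * indicator {z} (Some y) + (1 - ?a y) * indicator {z} None))
       = (\<Sum>y\<in>Y. (pmf \<mu> y * ?a y) * indicator {x} y)"
      using Some by (intro sum.cong) (auto simp: indicator_def)
    also have "\<dots> = pmf \<mu> x * ?a x"
    proof (cases "x \<in> Y")
      case True
      then show ?thesis using Y(1) by (simp add: indicator_def)
    next
      case False
      then have "pmf \<mu> x = 0" using Y(2) by (auto simp: set_pmf_iff)
      then show ?thesis using False by (auto simp: indicator_def intro!: sum.neutral)
    qed
    also have "\<dots> = ?t * pmf \<rho> x"
    proof (cases "pmf \<mu> x = 0")
      case False
      then have "0 < pmf \<mu> x" by simp
      then show ?thesis unfolding assms by (auto simp: max_def field_simps)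
    qed (simp add: assms)
    finally show ?thesis
      using Some rejection_nonneg[of \<mu> \<nu>] rejection_le_1 by (simp add: mixture_def pmf_bind pmf_map_inj')
  qed
  finally show "pmf (bind_pmf \<mu> (\<lambda>y. map_pmf (\<lambda>b. if b then Some y else None) (bernoulli_pmf (?a y)))) z
     = pmf (mixture ?t \<rho>) z" .
qed

end

text \<open>The normalized positive part of \<open>\<mu> - \<nu>\<close>, from the list of pairs of
  densities. If no difference is positive the weights cannot be normalized; the law of the result
  matters only at positive \<open>rejection\<close>.\<close>

definition residual :: "'a list \<Rightarrow> (real \<times> real) list \<Rightarrow> 'a pmf" where
  "residual ys ws = (let us = map (\<lambda>(m, v). max 0 (m - v)) ws
     in pmf_of_list (zip ys (map (\<lambda>u. u / sum_list us) us)))"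

lemma sum_list_filter_fst:
  "distinct ys \<Longrightarrow> sum_list (map snd (filter (\<lambda>z. fst z = x) (map (\<lambda>y. (y, f y)) ys)))
    = (if x \<in> set ys then f x else (0::real))"
  by (induction ys) auto

lemma pmf_residual:
  assumes ys: "distinct ys" "set_pmf \<mu> \<subseteq> set ys" "set_pmf \<nu> \<subseteq> set ys" and pos: "0 < rejection \<mu> \<nu>"
  shows "rejection \<mu> \<nu> * pmf (residual ys (map (\<lambda>y. (pmf \<mu> y, pmf \<nu> y)) ys)) z = max 0 (pmf \<mu> z - pmf \<nu> z)"
proof -
  let ?u = "\<lambda>y. max 0 (pmf \<mu> y - pmf \<nu> y)" and ?t = "rejection \<mu> \<nu>"
  have t: "sum_list (map ?u ys) = ?t"
    using ys by (simp add: rejection_eq[of "set ys"] sum_list_distinct_conv_sum_set)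
  have "residual ys (map (\<lambda>y. (pmf \<mu> y, pmf \<nu> y)) ys) = pmf_of_list (map (\<lambda>y. (y, ?u y / ?t)) ys)"
    by (simp add: residual_def t o_def zip_map2 zip_same_conv_map)
  moreover have "pmf_of_list_wf (map (\<lambda>y. (y, ?u y / ?t)) ys)"
  proof (rule pmf_of_list_wfI)
    have "sum_list (map (\<lambda>y. ?u y / ?t) ys) = sum_list (map ?u ys) / ?t"
      by (simp add: sum_list_distinct_conv_sum_set ys sum_divide_distrib)
    then show "sum_list (map snd (map (\<lambda>y. (y, ?u y / ?t)) ys)) = 1"
      using pos by (simp add: o_def t)
  qed (use pos in auto)
  ultimately have "pmf (residual ys (map (\<lambda>y. (pmf \<mu> y, pmf \<nu> y)) ys)) z = (if z \<in> set ys then ?u z / ?t else 0)"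
    by (simp add: pmf_pmf_of_list sum_list_filter_fst ys)
  moreover have "pmf \<mu> z = 0" if "z \<notin> set ys" using that ys by (auto simp: set_pmf_iff)
  ultimately show ?thesis using pos by auto
qed

section \<open>Speculation as a program\<close>

definition test :: "('a \<Rightarrow> (real \<times> real) prog) \<Rightarrow> (real \<Rightarrow> real \<Rightarrow> real) \<Rightarrow> 'a \<Rightarrow> bool prog" where
  "test W a y = bindp (W y) (\<lambda>(m, v). coin (bernoulli_pmf (a m v)))"

definition attempt :: "('a \<Rightarrow> (real \<times> real) prog) \<Rightarrow> 'a prog \<Rightarrow> 'a option prog" where
  "attempt W A = bindp A (\<lambda>y. mapp (\<lambda>b. if b then Some y else None) (test W (\<lambda>m v. max 0 (1 - v / m)) y))"

definition fallback :: "('a \<Rightarrow> (real \<times> real) prog) \<Rightarrow> 'a list \<Rightarrow> 'a prog" where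
  "fallback W ys = bindp (parl (map W ys)) (\<lambda>ws. coin (residual ys ws))"

text \<open>\<open>W y\<close> returns the pair of \<open>\<mu> y\<close> and
  \<open>\<nu> y\<close>, \<open>N\<close> draws from \<open>\<nu>\<close>, \<open>A\<close> from
  \<open>\<mu>\<close>, and \<open>ys\<close> enumerates all candidates. Its length serves as fuel,
  matching the number of weighings in \<open>fallback\<close>.\<close>

definition speculate :: "nat \<Rightarrow> ('a \<Rightarrow> (real \<times> real) prog) \<Rightarrow> 'a prog \<Rightarrow> 'a prog \<Rightarrow> 'a list \<Rightarrow> 'a prog" where
  "speculate L W N A ys = bindp N (\<lambda>y. bindp (test W (\<lambda>m v. min 1 (m / v)) y) (\<lambda>b.
     if b then Ret y else retry L (attempt W A) (fallback W ys) (length ys) 0))"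

lemma cost_test: "cost orc (test W a y) = cost orc (W y)"
  by (simp add: test_def case_prod_unfold)

lemma excess_test: "excess orc 1 (W y) = 0 \<Longrightarrow> excess orc 2 (test W a y) = 0"
  using excess_bindp[of orc 1 1 "W y" "\<lambda>(m, v). coin (bernoulli_pmf (a m v))"]
  by (simp add: test_def case_prod_unfold numeral_2_eq_2)

lemma law_test: "law orc (W y) = return_pmf (m, v) \<Longrightarrow> law orc (test W a y) = bernoulli_pmf (a m v)"
  by (simp add: test_def bind_return_pmf)

text \<open>The allowance 3 is the draft, the weighing and the coin of an accepted block. An attempt
  takes 6 for \<open>A\<close>, which will sample two halves in sequence, and 2 for its test, whence
  the 8 per batch. In the query bound the last \<open>w\<close> pays for the fallback.\<close>

lemma speculate:
  fixes orc :: "query \<Rightarrow> answer pmf"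
  assumes ys: "distinct ys" "set_pmf \<mu> \<subseteq> set ys" "set_pmf \<nu> \<subseteq> set ys"
    and N: "law orc N = \<nu>" "excess orc 1 N = 0" and A: "law orc A = \<mu>"
    and W: "\<And>y. y \<in> set ys \<Longrightarrow> law orc (W y) = return_pmf (pmf \<mu> y, pmf \<nu> y)"
      "\<And>y. y \<in> set ys \<Longrightarrow> excess orc 1 (W y) = 0" "\<And>y. y \<in> set ys \<Longrightarrow> cost orc (W y) = w"
    and L: "0 < L"
  shows "law orc (speculate L W N A ys) = \<mu>"
    and "cost orc (speculate L W N A ys)
      \<le> cost orc N + w + (ennreal (1 + 1 / real L) * (cost orc A + w) + w)"
    and "excess orc 3 (speculate L W N A ys)
      \<le> ennreal (8 * (real J * rejection \<mu> \<nu> + (real L + 1) / (1 + 1 / real L) ^ J))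
        + ennreal (1 + 1 / real L) * excess orc 6 A"
proof -
  define t where "t = rejection \<mu> \<nu>"
  define R where "R = retry L (attempt W A) (fallback W ys) (length ys) 0"
  define \<rho> where "\<rho> = residual ys (map (\<lambda>y. (pmf \<mu> y, pmf \<nu> y)) ys)"
  note Y = finite_set[of ys] ys(2,3)
  have t: "0 \<le> t" "t \<le> 1" using rejection_nonneg[of \<mu> \<nu>] rejection_le_1[OF Y] by (auto simp: t_def)
  have fb: "law orc (fallback W ys) = \<rho>"
    using law_parl_return[of ys orc W "\<lambda>y. (pmf \<mu> y, pmf \<nu> y)"] W(1)
    by (simp add: fallback_def \<rho>_def bind_return_pmf)
  have att: "law orc (attempt W A) = bind_pmf \<mu> (\<lambda>y. map_pmf (\<lambda>b. if b then Some y else None)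
    (bernoulli_pmf (max 0 (1 - pmf \<nu> y / pmf \<mu> y))))"
    unfolding attempt_def law_bindp A
    using ys W(1) by (intro bind_pmf_cong refl) (auto simp: law_test map_pmf_def)
  have test: "bind_pmf (law orc (test W (\<lambda>m v. min 1 (m / v)) y)) g
      = bind_pmf (bernoulli_pmf (min 1 (pmf \<mu> y / pmf \<nu> y))) g" if "y \<in> set_pmf \<nu>" for y and g :: "bool \<Rightarrow> 'a pmf"
    using that ys W(1) by (subst law_test) auto
  have \<rho>: "t * pmf \<rho> z = max 0 (pmf \<mu> z - pmf \<nu> z)" if "0 < t" for z
    using pmf_residual[OF ys] that by (simp add: t_def \<rho>_def)
  have mix: "law orc (attempt W A) = mixture t \<rho>" if "0 < t"
    unfolding att t_def using attempt_mixture[OF Y] \<rho>[OF that] by (simp add: t_def)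
  have R: "t * pmf (law orc R) z = max 0 (pmf \<mu> z - pmf \<nu> z)" for z
  proof (cases "t = 0")
    case True
    have "max 0 (pmf \<mu> y - pmf \<nu> y) = 0" if "y \<in> set ys" for y
      using True that rejection_eq[OF Y] by (subst (asm) t_def) (simp add: sum_nonneg_eq_0_iff)
    moreover have "pmf \<mu> y = 0" if "y \<notin> set ys" for y using that ys by (auto simp: set_pmf_iff)
    ultimately show ?thesis using True by (cases "z \<in> set ys") auto
  next
    case False
    then have "0 < t" using t by simp
    then show ?thesis using law_retry[OF mix fb] \<rho> by (simp add: R_def)
  qed
  have "law orc (speculate L W N A ys) = bind_pmf \<nu> (\<lambda>y. bind_pmf (law orc (test W (\<lambda>m v. min 1 (m / v)) y))
    (\<lambda>b. if b then return_pmf y else law orc R))"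
    unfolding speculate_def R_def law_bindp N
    by (intro bind_pmf_cong refl) auto
  also have "\<dots> = bind_pmf \<nu> (\<lambda>y. bind_pmf (bernoulli_pmf (min 1 (pmf \<mu> y / pmf \<nu> y)))
    (\<lambda>b. if b then return_pmf y else law orc R))"
    by (intro bind_pmf_cong refl test)
  also have "\<dots> = \<mu>" using R unfolding t_def by (rule speculation_correct[OF Y])
  finally show "law orc (speculate L W N A ys) = \<mu>" .

  \<comment> \<open>Averaged over the draft, the branch entered upon rejection is weighted by
    exactly \<open>t\<close>.\<close>
  have rej: "(\<integral>\<^sup>+y. (\<integral>\<^sup>+b. (if b then 0 else c) \<partial>law orc (test W (\<lambda>m v. min 1 (m / v)) y)) \<partial>\<nu>) = ennreal t * c" for c
  proof -
    let ?a = "\<lambda>y. min 1 (pmf \<mu> y / pmf \<nu> y)"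
    have "(\<integral>\<^sup>+y. (\<integral>\<^sup>+b. (if b then 0 else c) \<partial>law orc (test W (\<lambda>m v. min 1 (m / v)) y)) \<partial>\<nu>)
      = (\<integral>\<^sup>+y. (\<integral>\<^sup>+b. (if b then 0 else c) \<partial>bernoulli_pmf (?a y)) \<partial>\<nu>)"
      using ys W(1) by (intro nn_integral_cong_AE AE_pmfI) (subst law_test, auto)
    also have "\<dots> = (\<integral>\<^sup>+y. ennreal (1 - ?a y) * c \<partial>\<nu>)"
      by (intro nn_integral_cong) (simp add: ennreal_minus[symmetric] mult.commute)
    also have "\<dots> = ennreal (measure_pmf.expectation \<nu> (\<lambda>y. 1 - ?a y)) * c"
      using finite_subset[OF ys(3)] by (simp add: nn_integral_multc nn_integral_pmf_finite)
    also have "measure_pmf.expectation \<nu> (\<lambda>y. 1 - ?a y) = t"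
      unfolding t_def rejection_eq'[OF Y] by (rule expectation_pmf_finite[OF Y(1,3)])
    finally show ?thesis .
  qed
  have exF: "excess orc 8 (fallback W ys) = 0"
  proof -
    have "excess orc 8 (fallback W ys) \<le> excess orc (1 + 1) (fallback W ys)" by (rule excess_antimono) simp
    also have "\<dots> \<le> excess orc 1 (parl (map W ys)) + (\<integral>\<^sup>+ws. excess orc 1 (coin (residual ys ws)) \<partial>law orc (parl (map W ys)))"
      unfolding fallback_def by (rule excess_bindp)
    also have "\<dots> = 0" using W(2) by (subst excess_parl) auto
    finally show ?thesis by simp
  qed
  have exA: "excess orc 8 (attempt W A) \<le> excess orc 6 A"
  proof -
    have "excess orc (6 + 2) (attempt W A) \<le> excess orc 6 A +
        (\<integral>\<^sup>+y. excess orc 2 (mapp (\<lambda>b. if b then Some y else None) (test W (\<lambda>m v. max 0 (1 - v / m)) y)) \<partial>law orc A)"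
      unfolding attempt_def by (rule excess_bindp)
    also have "(\<integral>\<^sup>+y. excess orc 2 (mapp (\<lambda>b. if b then Some y else None) (test W (\<lambda>m v. max 0 (1 - v / m)) y)) \<partial>law orc A)
        = (\<integral>\<^sup>+y. 0 \<partial>law orc A)"
      using ys W(2) by (intro nn_integral_cong_AE AE_pmfI) (auto simp: A intro!: excess_test)
    finally show ?thesis by simp
  qed
  have coA: "cost orc (attempt W A) = cost orc A + w"
  proof -
    have "cost orc (attempt W A) = cost orc A + (\<integral>\<^sup>+y. w \<partial>law orc A)"
      unfolding attempt_def cost_bindp
      using ys W(3) by (intro arg_cong2[where f = "(+)"] refl nn_integral_cong_AE AE_pmfI) (auto simp: A cost_test)
    then show ?thesis by simp
  qed
  have coF: "cost orc (fallback W ys) = of_nat (length ys) * w"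
  proof -
    have "(\<Sum>A\<leftarrow>map W ys. cost orc A) = (\<Sum>y\<leftarrow>ys. w)"
      using W(3) by (simp add: o_def cong: map_cong)
    then show ?thesis by (simp add: fallback_def cost_parl sum_list_triv)
  qed
  have coR: "ennreal t * cost orc R \<le> ennreal (1 + 1 / real L) * (cost orc A + w) + w"
  proof (cases "t = 0")
    case False
    then have pos: "0 < t" using t by simp
    \<comment> \<open>The \<open>length ys\<close> weighings of the fallback are compensated by the
      weight \<open>1 / (length ys + 1)\<close> that the fuel guarantees.\<close>
    have "ennreal (1 / (real (length ys) + 1)) * (of_nat (length ys) * w)
        = ennreal (1 / (real (length ys) + 1) * real (length ys)) * w"
      by (subst ennreal_mult) (simp_all add: ennreal_of_nat_eq_real_of_nat mult.assoc)
    also have "\<dots> \<le> ennreal 1 * w"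
      by (intro mult_right_mono ennreal_leI) auto
    finally show ?thesis
      using retry_bound_rejected(1)[OF mix[OF pos] pos t(2) exF L, of "length ys"]
      by (fold R_def) (auto simp: coA coF intro: order_trans add_left_mono)
  qed simp
  have exR: "ennreal t * excess orc 0 R \<le> ennreal (8 * (real J * t + (real L + 1) / (1 + 1 / real L) ^ J))
        + ennreal (1 + 1 / real L) * excess orc 6 A"
  proof (cases "t = 0")
    case False
    then have pos: "0 < t" using t by simp
    show ?thesis
      using retry_bound_rejected(2)[OF mix[OF pos] pos t(2) exF L, of "length ys" J]
        mult_left_mono[OF exA, of "ennreal (1 + 1 / real L)"]
      by (fold R_def) (simp only: of_nat_numeral, erule order_trans, rule add_left_mono, simp)
  qed simp
  have "cost orc (speculate L W N A ys) = cost orc N + (\<integral>\<^sup>+y. w +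
      (\<integral>\<^sup>+b. (if b then 0 else cost orc R) \<partial>law orc (test W (\<lambda>m v. min 1 (m / v)) y)) \<partial>\<nu>)"
    unfolding speculate_def cost_bindp N R_def[symmetric]
    using ys W(3)
    by (intro arg_cong2[where f = "(+)"] refl nn_integral_cong_AE AE_pmfI)
      (auto simp: cost_test intro!: nn_integral_cong)
  also have "\<dots> = cost orc N + w + ennreal t * cost orc R"
    by (simp add: nn_integral_add rej add.assoc)
  finally show "cost orc (speculate L W N A ys)
      \<le> cost orc N + w + (ennreal (1 + 1 / real L) * (cost orc A + w) + w)"
    using coR by (simp add: add_left_mono)

  have "excess orc (1 + (2 + 0)) (speculate L W N A ys) \<le> excess orc 1 N + (\<integral>\<^sup>+y. excess orc (2 + 0)
      (bindp (test W (\<lambda>m v. min 1 (m / v)) y) (\<lambda>b. if b then Ret y else R)) \<partial>\<nu>)"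
    unfolding speculate_def R_def N(1)[symmetric] by (rule excess_bindp)
  also have "\<dots> \<le> 0 + (\<integral>\<^sup>+y. 0 + 
      (\<integral>\<^sup>+b. (if b then 0 else excess orc 0 R) \<partial>law orc (test W (\<lambda>m v. min 1 (m / v)) y)) \<partial>\<nu>)"
  proof (intro add_mono nn_integral_mono_AE AE_pmfI)
    fix y assume y: "y \<in> set_pmf \<nu>"
    have "excess orc (2 + 0) (bindp (test W (\<lambda>m v. min 1 (m / v)) y) (\<lambda>b. if b then Ret y else R))
       \<le> excess orc 2 (test W (\<lambda>m v. min 1 (m / v)) y) +
        (\<integral>\<^sup>+b. excess orc 0 (if b then Ret y else R) \<partial>law orc (test W (\<lambda>m v. min 1 (m / v)) y))"
      by (rule excess_bindp)
    also have "excess orc 2 (test W (\<lambda>m v. min 1 (m / v)) y) = 0"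
      using y ys W(2) by (intro excess_test) auto
    also have "(\<integral>\<^sup>+b. excess orc 0 (if b then Ret y else R) \<partial>law orc (test W (\<lambda>m v. min 1 (m / v)) y))
      = (\<integral>\<^sup>+b. (if b then 0 else excess orc 0 R) \<partial>law orc (test W (\<lambda>m v. min 1 (m / v)) y))"
      by (intro nn_integral_cong) auto
    finally show "excess orc (2 + 0) (bindp (test W (\<lambda>m v. min 1 (m / v)) y) (\<lambda>b. if b then Ret y else R))
       \<le> 0 + (\<integral>\<^sup>+b. (if b then 0 else excess orc 0 R) \<partial>law orc (test W (\<lambda>m v. min 1 (m / v)) y))" .
  qed (use N in simp)
  also have "\<dots> = ennreal t * excess orc 0 R" by (simp add: rej)
  finally have "excess orc 3 (speculate L W N A ys) \<le> ennreal t * excess orc 0 R"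
    by (simp only: numeral_plus_numeral numeral_plus_one add_0_right one_plus_numeral semiring_norm)
  also note exR
  finally show "excess orc 3 (speculate L W N A ys)
      \<le> ennreal (8 * (real J * rejection \<mu> \<nu> + (real L + 1) / (1 + 1 / real L) ^ J))
        + ennreal (1 + 1 / real L) * excess orc 6 A"
    by (simp only: t_def)
qed

section \<open>The recursive sampler\<close>

primrec sequential :: "config pmf \<Rightarrow> nat list \<Rightarrow> config \<Rightarrow> config pmf" where
  "sequential \<pi> [] h = return_pmf h"
| "sequential \<pi> (i # xs) h = bind_pmf (cond_marginal \<pi> i h) (\<lambda>a. sequential \<pi> xs (h(i \<mapsto> a)))"

primrec factorized :: "config pmf \<Rightarrow> config \<Rightarrow> nat list \<Rightarrow> config \<Rightarrow> config pmf" where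
  "factorized \<pi> h [] g = return_pmf g"
| "factorized \<pi> h (i # xs) g = bind_pmf (cond_marginal \<pi> i h) (\<lambda>a. factorized \<pi> h xs (g(i \<mapsto> a)))"

primrec extensions :: "nat \<Rightarrow> nat list \<Rightarrow> config \<Rightarrow> config list" where
  "extensions q [] h = [h]"
| "extensions q (i # xs) h = concat (map (\<lambda>a. extensions q xs (h(i \<mapsto> a))) [1..<Suc q])"

lemma sequential_append:
  "sequential \<pi> (xs @ ys) h = bind_pmf (sequential \<pi> xs h) (sequential \<pi> ys)"
  by (induction xs arbitrary: h) (simp_all add: bind_return_pmf bind_assoc_pmf)

lemma sequential_agree: "y \<in> set_pmf (sequential \<pi> xs h) \<Longrightarrow> j \<notin> set xs \<Longrightarrow> y j = h j"
  by (induction xs arbitrary: h) auto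

lemma factorized_agree: "y \<in> set_pmf (factorized \<pi> h xs g) \<Longrightarrow> j \<notin> set xs \<Longrightarrow> y j = g j"
  by (induction xs arbitrary: g) auto

lemma set_extensions_Cons:
  "set (extensions q (i # xs) h) = (\<Union>a\<in>{1..q}. set (extensions q xs (h(i \<mapsto> a))))"
  by (simp add: atLeastLessThanSuc_atLeastAtMost del: upt_Suc)

lemma extensions_agree: "y \<in> set (extensions q xs h) \<Longrightarrow> j \<notin> set xs \<Longrightarrow> y j = h j"
  by (induction xs arbitrary: h) (auto simp del: upt_Suc)

lemma extensions_nonempty: "0 < q \<Longrightarrow> extensions q xs h \<noteq> []"
proof (induction xs arbitrary: h)
  case (Cons i xs)
  then show ?case by (auto simp del: upt_Suc intro!: bexI[of _ 1])
qed simp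

lemma distinct_extensions: "distinct xs \<Longrightarrow> distinct (extensions q xs h)"
proof (induction xs arbitrary: h)
  case (Cons i xs)
  let ?E = "\<lambda>a. extensions q xs (h(i \<mapsto> a))"
  have disj: "set (?E a) \<inter> set (?E b) = {}" if "a \<noteq> b" for a b
  proof -
    have "i \<notin> set xs" using Cons.prems by simp
    then have "y i = Some c" if "y \<in> set (?E c)" for y c
      using extensions_agree[OF that] by simp
    then show ?thesis using \<open>a \<noteq> b\<close> by (metis disjoint_iff option.inject)
  qed
  have "inj_on ?E (set [1..<Suc q])"
  proof (rule inj_onI, rule ccontr)
    fix a b assume "a \<in> set [1..<Suc q]" "?E a = ?E b" "a \<noteq> b"
    then show False using disj[of a b] extensions_nonempty[of q xs "h(i \<mapsto> a)"] by auto
  qed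
  then have *: "distinct (map ?E [1..<Suc q])" by (simp only: distinct_map distinct_upt simp_thms)
  show ?case
    unfolding extensions.simps
  proof (rule distinct_concat[OF *])
    fix ys assume "ys \<in> set (map ?E [1..<Suc q])"
    then obtain a where a: "ys = ?E a" by (auto simp del: upt_Suc)
    then show "distinct ys" using Cons by simp
    fix zs assume "zs \<in> set (map ?E [1..<Suc q])" "ys \<noteq> zs"
    then obtain b where b: "zs = ?E b" by (auto simp del: upt_Suc)
    then show "set ys \<inter> set zs = {}" using a disj[of a b] \<open>ys \<noteq> zs\<close> by blast
  qed
qed simp

lemma pmf_bind_cond_marginal:
  assumes "\<And>a. a \<noteq> b \<Longrightarrow> pmf (f a) y = 0"
  shows "pmf (bind_pmf M f) y = pmf M b * pmf (f b) y"
proof -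
  have "pmf (bind_pmf M f) y = measure_pmf.expectation M (\<lambda>a. pmf (f b) y * indicator {b} a)"
    unfolding pmf_bind using assms by (intro arg_cong[where f = "measure_pmf.expectation M"]) (auto simp: indicator_def)
  then show ?thesis by (simp add: measure_pmf_single)
qed

text \<open>Coordinate \<open>i\<close> is not touched by \<open>xs\<close>, so \<open>y\<close>
  reveals which value was drawn for it and only one term of the mixture survives.\<close>

lemma pmf_sequential_Cons:
  assumes "i \<notin> set xs" "y i = Some b"
  shows "pmf (sequential \<pi> (i # xs) h) y = pmf (cond_marginal \<pi> i h) b * pmf (sequential \<pi> xs (h(i \<mapsto> b))) y"
proof -
  have "pmf (sequential \<pi> xs (h(i \<mapsto> a))) y = 0" if "a \<noteq> b" for a
    using that assms sequential_agree[of y \<pi> xs "h(i \<mapsto> a)" i] by (auto simp: pmf_eq_0_set_pmf)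
  then show ?thesis by (simp add: pmf_bind_cond_marginal[where b = b])
qed

lemma pmf_factorized_Cons:
  assumes "i \<notin> set xs" "y i = Some b"
  shows "pmf (factorized \<pi> h (i # xs) g) y = pmf (cond_marginal \<pi> i h) b * pmf (factorized \<pi> h xs (g(i \<mapsto> b))) y"
proof -
  have "pmf (factorized \<pi> h xs (g(i \<mapsto> a))) y = 0" if "a \<noteq> b" for a
    using that assms factorized_agree[of y \<pi> h xs "g(i \<mapsto> a)" i] by (auto simp: pmf_eq_0_set_pmf)
  then show ?thesis by (simp add: pmf_bind_cond_marginal[where b = b])
qed

section \<open>Drafts and weights in one round\<close>

definition ask :: "query list \<Rightarrow> (answer list \<Rightarrow> 'r) \<Rightarrow> 'r prog" where
  "ask cs g = Ask cs (\<lambda>as. return_pmf (Ret (g as)))"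

lemma law_ask: "law orc (ask cs g) = map_pmf g (answers orc cs)"
  using law_Ask_Ret[of orc cs "\<lambda>as _. g as" "\<lambda>_. return_pmf ()"] by (simp add: ask_def map_pmf_def)

lemma excess_ask: "0 < d \<Longrightarrow> excess orc d (ask cs g) = 0"
  using excess_Ask_Ret[of d orc cs "\<lambda>as _. g as" "\<lambda>_. return_pmf ()"] by (simp add: ask_def)

lemma cost_ask: "cost orc (ask cs g) = of_nat (length cs)"
  using cost_Ask_Ret[of orc cs "\<lambda>as _. g as" "\<lambda>_. return_pmf ()"] by (simp add: ask_def)

definition draft :: "nat list \<Rightarrow> config \<Rightarrow> config prog" where
  "draft xs h = ask (map (Sampling h) xs)
     (\<lambda>as. h(xs [\<mapsto>] map (\<lambda>a. case a of Val v \<Rightarrow> v | Prob r \<Rightarrow> 0) as))"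

text \<open>The candidate \<open>y\<close> is known when it is weighed, hence so are all prefixes in
  the chain rule, and its factors can be asked in a single round.\<close>

primrec chain :: "nat list \<Rightarrow> config \<Rightarrow> config \<Rightarrow> query list" where
  "chain [] y h = []"
| "chain (i # xs) y h = Density h i (the (y i)) # chain xs y (h(i := y i))"

definition likelihood :: "answer list \<Rightarrow> real" where
  "likelihood as = prod_list (map (\<lambda>a. case a of Val v \<Rightarrow> 0 | Prob r \<Rightarrow> r) as)"

definition weigh :: "nat list \<Rightarrow> config \<Rightarrow> config \<Rightarrow> (real \<times> real) prog" where
  "weigh xs h y = ask (chain xs y h @ map (\<lambda>i. Density h i (the (y i))) xs)
     (\<lambda>as. (likelihood (take (length xs) as), likelihood (drop (length xs) as)))"

lemma length_chain [simp]: "length (chain xs y h) = length xs"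
  by (induction xs arbitrary: h) auto

text \<open>Level \<open>l\<close> serves blocks of length at most \<open>2 ^ l\<close>; at level 0
  the draft is already exact. The second half takes the output of the first as its prefix.
  \<open>L\<close> stays fixed along the recursion.\<close>

primrec sampler :: "nat \<Rightarrow> nat \<Rightarrow> nat \<Rightarrow> nat list \<Rightarrow> config \<Rightarrow> config prog" where
  "sampler L q 0 xs h = draft xs h"
| "sampler L q (Suc l) xs h = speculate L (weigh xs h) (draft xs h)
     (bindp (sampler L q l (take (2 ^ l) xs) h) (sampler L q l (drop (2 ^ l) xs))) (extensions q xs h)"

lemma cost_draft: "cost orc (draft xs h) = of_nat (length xs)"
  by (simp add: draft_def cost_ask)

lemma excess_draft: "excess orc 1 (draft xs h) = 0"
  by (simp add: draft_def excess_ask)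

lemma cost_weigh: "cost orc (weigh xs h y) = of_nat (2 * length xs)"
  by (simp add: weigh_def cost_ask mult_2)

lemma excess_weigh: "excess orc 1 (weigh xs h y) = 0"
  by (simp add: weigh_def excess_ask)

section \<open>Conditional marginals and the oracle\<close>

locale conditional_queries =
  fixes n q :: nat and \<pi> :: "config pmf" and orc :: "query \<Rightarrow> answer pmf"
  assumes supp: "set_pmf \<pi> \<subseteq> configs {1..n} q" and orc: "conditional_oracle n q \<pi> orc"
begin

abbreviation P :: "config \<Rightarrow> real" where
  "P h \<equiv> measure_pmf.prob \<pi> (agreeing h)"

definition possible :: "config \<Rightarrow> bool" where
  "possible h \<longleftrightarrow> dom h \<subseteq> {1..n} \<and> ran h \<subseteq> {1..q} \<and> P h > 0"

definition block :: "nat list \<Rightarrow> config \<Rightarrow> bool" where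
  "block xs h \<longleftrightarrow> possible h \<and> distinct xs \<and> set xs \<subseteq> {1..n} - dom h"

lemma support:
  assumes "X \<in> set_pmf \<pi>"
  shows "dom X = {1..n}" "ran X \<subseteq> {1..q}"
  using assms supp by (auto simp: configs_def)

lemma P_empty: "P Map.empty = 1"
  by (simp add: agreeing_def)

lemma possible_empty: "possible Map.empty"
  by (simp add: possible_def P_empty)

lemma pmf_cond_marginal:
  assumes "P h > 0" "i \<in> {1..n} - dom h"
  shows "pmf (cond_marginal \<pi> i h) a = P (h(i \<mapsto> a)) / P h"
proof -
  have ne: "set_pmf \<pi> \<inter> agreeing h \<noteq> {}"
    using assms(1) by (auto simp: measure_pmf_zero_iff[symmetric])
  have "pmf (cond_marginal \<pi> i h) a = measure_pmf.prob (cond_pmf \<pi> (agreeing h)) ((\<lambda>X. the (X i)) -` {a})"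
    by (simp add: cond_marginal_def pmf_map)
  also have "\<dots> = measure_pmf.prob \<pi> (agreeing h \<inter> (\<lambda>X. the (X i)) -` {a}) / P h"
    unfolding cond_pmf.rep_eq[OF ne]
    by (subst measure_uniform_measure) (auto simp: emeasure_measure_pmf_not_zero[OF ne])
  also have "measure_pmf.prob \<pi> (agreeing h \<inter> (\<lambda>X. the (X i)) -` {a}) = P (h(i \<mapsto> a))"
  proof (rule measure_pmf.finite_measure_eq_AE)
    \<comment> \<open>Configurations in the support are defined at \<open>i\<close>, so
      \<open>the\<close> loses nothing and the two events agree almost surely.\<close>
    have "X \<in> agreeing h \<inter> (\<lambda>X. the (X i)) -` {a} \<longleftrightarrow> X \<in> agreeing (h(i \<mapsto> a))" if "X \<in> set_pmf \<pi>" for X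
    proof -
      have "i \<in> dom X" using support[OF that] assms(2) by auto
      then show ?thesis using assms(2)
        by (fastforce simp: agreeing_def map_le_def dom_def)
    qed
    then show "AE X in \<pi>. (X \<in> agreeing h \<inter> (\<lambda>X. the (X i)) -` {a}) = (X \<in> agreeing (h(i \<mapsto> a)))"
      by (intro AE_pmfI) auto
  qed auto
  finally show ?thesis .
qed

lemma P_pos_ran:
  assumes "P h > 0" shows "ran h \<subseteq> {1..q}"
proof -
  have "set_pmf \<pi> \<inter> agreeing h \<noteq> {}" using assms measure_pmf_zero_iff[of \<pi> "agreeing h"] by auto
  then obtain X where X: "X \<in> set_pmf \<pi>" "h \<subseteq>\<^sub>m X" by (auto simp: agreeing_def)
  then have "ran h \<subseteq> ran X" by (force simp: map_le_def ran_def dom_def)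
  then show ?thesis using support[OF X(1)] by auto
qed

lemma possible_update:
  assumes "possible h" "i \<in> {1..n} - dom h" "a \<in> set_pmf (cond_marginal \<pi> i h)"
  shows "possible (h(i \<mapsto> a))" "a \<in> {1..q}"
proof -
  have "P (h(i \<mapsto> a)) > 0"
    using assms pmf_cond_marginal[of h i a] 
    by (auto simp: possible_def set_pmf_iff less_le)
  moreover from P_pos_ran[OF this] have "a \<in> {1..q}" by (meson ranI fun_upd_same subsetD)
  ultimately show "possible (h(i \<mapsto> a))" "a \<in> {1..q}"
    using assms by (auto simp: possible_def dest!: P_pos_ran)
qed

lemma block_update:
  "block (i # xs) h \<Longrightarrow> a \<in> set_pmf (cond_marginal \<pi> i h) \<Longrightarrow> block xs (h(i \<mapsto> a))"
  using possible_update(1)[of h i a] by (auto simp: block_def)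

lemma admissible: "possible h \<Longrightarrow> i \<in> {1..n} - dom h \<Longrightarrow> admissible n q \<pi> h i"
  by (auto simp: admissible_def possible_def configs_def)

lemma oracle_Sampling: "possible h \<Longrightarrow> i \<in> {1..n} - dom h \<Longrightarrow>
    orc (Sampling h i) = map_pmf Val (cond_marginal \<pi> i h)"
  using orc admissible by (auto simp: conditional_oracle_def)

lemma oracle_Density: "possible h \<Longrightarrow> i \<in> {1..n} - dom h \<Longrightarrow> a \<in> {1..q} \<Longrightarrow>
    orc (Density h i a) = return_pmf (Prob (pmf (cond_marginal \<pi> i h) a))"
  using orc admissible by (auto simp: conditional_oracle_def)

section \<open>Correctness of the sampler\<close>

lemma sequential_extensions:
  "block xs h \<Longrightarrow> set_pmf (sequential \<pi> xs h) \<subseteq> set (extensions q xs h)"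
proof (induction xs arbitrary: h)
  case (Cons i xs)
  show ?case
  proof
    fix y assume "y \<in> set_pmf (sequential \<pi> (i # xs) h)"
    then obtain a where a: "a \<in> set_pmf (cond_marginal \<pi> i h)" "y \<in> set_pmf (sequential \<pi> xs (h(i \<mapsto> a)))" by auto
    moreover have "a \<in> {1..q}" using possible_update(2) a(1) Cons.prems by (auto simp: block_def)
    ultimately show "y \<in> set (extensions q (i # xs) h)"
      using Cons.IH[OF block_update[OF Cons.prems a(1)]] unfolding set_extensions_Cons by blast
  qed
qed simp

lemma factorized_extensions:
  "block xs h \<Longrightarrow> set_pmf (factorized \<pi> h xs g) \<subseteq> set (extensions q xs g)"
proof (induction xs arbitrary: g)
  case (Cons i xs)
  have b: "block xs h" using Cons.prems by (auto simp: block_def)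
  show ?case
  proof
    fix y assume "y \<in> set_pmf (factorized \<pi> h (i # xs) g)"
    then obtain a where a: "a \<in> set_pmf (cond_marginal \<pi> i h)" "y \<in> set_pmf (factorized \<pi> h xs (g(i \<mapsto> a)))" by auto
    moreover have "a \<in> {1..q}" using possible_update(2) a(1) Cons.prems by (auto simp: block_def)
    ultimately show "y \<in> set (extensions q (i # xs) g)"
      using Cons.IH[OF b, of "g(i \<mapsto> a)"] unfolding set_extensions_Cons by blast
  qed
qed simp

lemma block_append:
  "block (xs @ ys) h \<Longrightarrow> y \<in> set_pmf (sequential \<pi> xs h) \<Longrightarrow> block ys y"
proof (induction xs arbitrary: h)
  case (Cons i xs)
  then show ?case using block_update[of i "xs @ ys" h] by auto
qed simp

lemma block_appendD: "block (xs @ ys) h \<Longrightarrow> block xs h"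
  by (auto simp: block_def)

lemma law_draft: "block xs h \<Longrightarrow> law orc (draft xs h) = factorized \<pi> h xs h"
proof -
  let ?val = "\<lambda>a. case a of Val v \<Rightarrow> v | Prob r \<Rightarrow> 0"
  have *: "bind_pmf (answers orc (map (Sampling h) xs)) (\<lambda>as. return_pmf (g(xs [\<mapsto>] map ?val as)))
     = factorized \<pi> h xs g" if "block xs h" for g
    using that
  proof (induction xs arbitrary: g)
    case (Cons i xs)
    have b: "block xs h" using Cons.prems by (auto simp: block_def)
    have "orc (Sampling h i) = map_pmf Val (cond_marginal \<pi> i h)"
      using Cons.prems by (intro oracle_Sampling) (auto simp: block_def)
    then show ?case
      by (simp add: bind_map_pmf bind_assoc_pmf bind_return_pmf Cons.IH[OF b] del: fun_upd_apply)
  qed (simp add: bind_return_pmf)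
  assume "block xs h"
  from *[OF this, of h] show ?thesis
by (simp add: draft_def law_ask map_pmf_def)
qed

text \<open>Once a factor vanishes the later queries of the chain are inadmissible, but then their
  answers do not affect the product.\<close>

lemma likelihood_chain:
  "block xs h \<Longrightarrow> y \<in> set (extensions q xs h) \<Longrightarrow> as \<in> set_pmf (answers orc (chain xs y h)) \<Longrightarrow>
    likelihood as = pmf (sequential \<pi> xs h) y"
proof (induction xs arbitrary: h as)
  case (Cons i xs)
  obtain a where a: "a \<in> {1..q}" "y \<in> set (extensions q xs (h(i \<mapsto> a)))"
    using Cons.prems(2) unfolding set_extensions_Cons by blast
  have i: "i \<notin> set xs" using Cons.prems(1) by (auto simp: block_def)
  have yi: "y i = Some a" using extensions_agree[OF a(2) i] by simp
  have "orc (Density h i a) = return_pmf (Prob (pmf (cond_marginal \<pi> i h) a))"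
    using Cons.prems(1) a by (intro oracle_Density) (auto simp: block_def)
  then obtain bs where bs: "as = Prob (pmf (cond_marginal \<pi> i h) a) # bs"
    "bs \<in> set_pmf (answers orc (chain xs y (h(i \<mapsto> a))))"
    using Cons.prems(3) yi by auto
  have "likelihood as = pmf (cond_marginal \<pi> i h) a * likelihood bs"
    by (simp add: bs likelihood_def)
  also have "\<dots> = pmf (cond_marginal \<pi> i h) a * pmf (sequential \<pi> xs (h(i \<mapsto> a))) y"
  proof (cases "a \<in> set_pmf (cond_marginal \<pi> i h)")
    case True
    have "likelihood bs = pmf (sequential \<pi> xs (h(i \<mapsto> a))) y"
      by (rule Cons.IH[OF block_update[OF Cons.prems(1) True] a(2) bs(2)])
    then show ?thesis by simp
  next
    case False
    then show ?thesis by (simp add: set_pmf_iff)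
  qed
  finally show ?case using pmf_sequential_Cons[where y = y, OF i yi] by simp
qed (simp add: likelihood_def)

lemma likelihood_factorized:
  "block xs h \<Longrightarrow> y \<in> set (extensions q xs g) \<Longrightarrow>
    as \<in> set_pmf (answers orc (map (\<lambda>i. Density h i (the (y i))) xs)) \<Longrightarrow>
    likelihood as = pmf (factorized \<pi> h xs g) y"
proof (induction xs arbitrary: g as)
  case (Cons i xs)
  obtain a where a: "a \<in> {1..q}" "y \<in> set (extensions q xs (g(i \<mapsto> a)))"
    using Cons.prems(2) unfolding set_extensions_Cons by blast
  have i: "i \<notin> set xs" and b: "block xs h" using Cons.prems(1) by (auto simp: block_def)
  have yi: "y i = Some a" using extensions_agree[OF a(2) i] by simp
  have "orc (Density h i a) = return_pmf (Prob (pmf (cond_marginal \<pi> i h) a))"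
    using Cons.prems(1) a by (intro oracle_Density) (auto simp: block_def)
  then obtain bs where bs: "as = Prob (pmf (cond_marginal \<pi> i h) a) # bs"
    "bs \<in> set_pmf (answers orc (map (\<lambda>i. Density h i (the (y i))) xs))"
    using Cons.prems(3) yi by auto
  have "likelihood as = pmf (cond_marginal \<pi> i h) a * likelihood bs"
    by (simp add: bs likelihood_def)
  also have "likelihood bs = pmf (factorized \<pi> h xs (g(i \<mapsto> a))) y"
    by (rule Cons.IH[OF b a(2) bs(2)])
  finally show ?case using pmf_factorized_Cons[where y = y, OF i yi] by simp
qed (simp add: likelihood_def)

text \<open>Single answers to inadmissible queries may be random, but both products are determined,
  so weighing has a deterministic result.\<close>

lemma law_weigh:
  assumes "block xs h" "y \<in> set (extensions q xs h)"
  shows "law orc (weigh xs h y) = return_pmf (pmf (sequential \<pi> xs h) y, pmf (factorized \<pi> h xs h) y)"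
proof -
  have "law orc (weigh xs h y) = bind_pmf (answers orc (chain xs y h)) (\<lambda>as.
     bind_pmf (answers orc (map (\<lambda>i. Density h i (the (y i))) xs)) (\<lambda>bs. return_pmf (likelihood as, likelihood bs)))"
    unfolding weigh_def law_ask
    by (auto simp: answers_append map_bind_pmf pmf.map_comp o_def map_pmf_def[symmetric]
        dest!: length_answers intro!: bind_pmf_cong)
  also have "\<dots> = bind_pmf (answers orc (chain xs y h)) (\<lambda>as.
     bind_pmf (answers orc (map (\<lambda>i. Density h i (the (y i))) xs)) (\<lambda>bs.
       return_pmf (pmf (sequential \<pi> xs h) y, pmf (factorized \<pi> h xs h) y)))"
    using likelihood_chain[OF assms] likelihood_factorized[OF assms] by (intro bind_pmf_cong refl) auto
  finally show ?thesis by simp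
qed

lemma sampler_halves:
  assumes "block xs h" "length xs \<le> 2 ^ Suc l"
  shows "block (take (2 ^ l) xs) h" "length (take (2 ^ l) xs) \<le> 2 ^ l" "length (drop (2 ^ l) xs) \<le> 2 ^ l"
    "\<And>y. y \<in> set_pmf (sequential \<pi> (take (2 ^ l) xs) h) \<Longrightarrow> block (drop (2 ^ l) xs) y"
  using assms block_appendD[of "take (2 ^ l) xs" "drop (2 ^ l) xs" h]
    block_append[of "take (2 ^ l) xs" "drop (2 ^ l) xs" h] by auto

lemma law_sampler:
  assumes "0 < L"
  shows "block xs h \<Longrightarrow> length xs \<le> 2 ^ l \<Longrightarrow> law orc (sampler L q l xs h) = sequential \<pi> xs h"
proof (induction l arbitrary: xs h)
  case 0
  \<comment> \<open>With at most one coordinate, the product of the marginals and the chain rule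
    coincide.\<close>
  have "factorized \<pi> h xs h = sequential \<pi> xs h"
    using 0 by (cases xs) auto
  then show ?case using 0 law_draft by simp
next
  case (Suc l)
  note halves = sampler_halves[OF Suc.prems]
  have "law orc (bindp (sampler L q l (take (2 ^ l) xs) h) (sampler L q l (drop (2 ^ l) xs)))
    = bind_pmf (sequential \<pi> (take (2 ^ l) xs) h) (sequential \<pi> (drop (2 ^ l) xs))"
    unfolding law_bindp Suc.IH[OF halves(1,2)] 
    by (intro bind_pmf_cong refl Suc.IH halves)
  also have "\<dots> = sequential \<pi> xs h" by (simp add: sequential_append[symmetric])
  finally show ?case
    unfolding sampler.simps
    using Suc.prems assms
    by (intro speculate(1)[where w = "of_nat (2 * length xs)" and \<nu> = "factorized \<pi> h xs h"]
       distinct_extensions sequential_extensions factorized_extensions law_draft excess_draft law_weigh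
       excess_weigh cost_weigh) (auto simp: block_def)
qed

section \<open>Expected queries and rounds of the sampler\<close>

lemma sampler_step:
  assumes "0 < L" "block xs h" "length xs \<le> 2 ^ Suc l"
  defines "A \<equiv> bindp (sampler L q l (take (2 ^ l) xs) h) (sampler L q l (drop (2 ^ l) xs))"
  shows "cost orc (sampler L q (Suc l) xs h) \<le> of_nat (length xs) + of_nat (2 * length xs) +
      (ennreal (1 + 1 / real L) * (cost orc A + of_nat (2 * length xs)) + of_nat (2 * length xs))"
    and "excess orc 3 (sampler L q (Suc l) xs h)
      \<le> ennreal (8 * (real J * rejection (sequential \<pi> xs h) (factorized \<pi> h xs h)
            + (real L + 1) / (1 + 1 / real L) ^ J))
        + ennreal (1 + 1 / real L) * excess orc 6 A"
proof -
  note halves = sampler_halves[OF assms(2,3)]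
  have A: "law orc A = sequential \<pi> xs h"
  proof -
    have "law orc A = bind_pmf (sequential \<pi> (take (2 ^ l) xs) h) (sequential \<pi> (drop (2 ^ l) xs))"
      unfolding A_def law_bindp law_sampler[OF assms(1) halves(1,2)]
      by (intro bind_pmf_cong refl law_sampler halves assms(1))
    then show ?thesis by (simp add: sequential_append[symmetric])
  qed
  note s = speculate[OF distinct_extensions sequential_extensions[OF assms(2)]
     factorized_extensions[OF assms(2)] law_draft[OF assms(2)] excess_draft A law_weigh[OF assms(2)]
     excess_weigh cost_weigh assms(1)]
  show "cost orc (sampler L q (Suc l) xs h) \<le> of_nat (length xs) + of_nat (2 * length xs) +
      (ennreal (1 + 1 / real L) * (cost orc A + of_nat (2 * length xs)) + of_nat (2 * length xs))"
    using s(2) assms(2) unfolding A_def sampler.simps cost_draft by (simp add: block_def)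
  show "excess orc 3 (sampler L q (Suc l) xs h)
      \<le> ennreal (8 * (real J * rejection (sequential \<pi> xs h) (factorized \<pi> h xs h)
            + (real L + 1) / (1 + 1 / real L) ^ J))
        + ennreal (1 + 1 / real L) * excess orc 6 A"
    using s(3) assms(2) unfolding A_def sampler.simps by (simp add: block_def)
qed

text \<open>Up to the factor \<open>e = 1 + 1 / L \<le> 2\<close>, each level makes one recursive
  call in expectation. The overhead per coordinate is 1 for the draft, 2 for its test, 2 for the
  fallback and \<open>2 * e\<close> for the tests of attempts, hence at most 9.\<close>

lemma cost_sampler:
  assumes "0 < L"
  shows "block xs h \<Longrightarrow> length xs \<le> 2 ^ l \<Longrightarrow>
    cost orc (sampler L q l xs h) \<le> ennreal ((1 + 1 / real L) ^ l * (9 * real l + 1) * real (length xs))"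
proof (induction l arbitrary: xs h)
  case 0
  show ?case by (simp add: cost_draft ennreal_of_nat_eq_real_of_nat)
next
  case (Suc l)
  note halves = sampler_halves[OF Suc.prems]
  let ?A = "bindp (sampler L q l (take (2 ^ l) xs) h) (sampler L q l (drop (2 ^ l) xs))"
  define e where "e = 1 + 1 / real L"
  define c where "c = e ^ l * (9 * real l + 1)"
  have e: "1 \<le> e" "e \<le> 2" using assms by (auto simp: e_def)
  have c: "0 \<le> c" using e by (simp add: c_def)
  let ?n = "real (length xs)"
  have "cost orc ?A = cost orc (sampler L q l (take (2 ^ l) xs) h) +
     (\<integral>\<^sup>+y. cost orc (sampler L q l (drop (2 ^ l) xs) y) \<partial>sequential \<pi> (take (2 ^ l) xs) h)"
    by (simp add: law_sampler[OF assms halves(1,2)])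
  also have "\<dots> \<le> ennreal (c * real (length (take (2 ^ l) xs))) +
     (\<integral>\<^sup>+y. ennreal (c * real (length (drop (2 ^ l) xs))) \<partial>sequential \<pi> (take (2 ^ l) xs) h)"
    unfolding c_def e_def by (intro add_mono nn_integral_mono_AE AE_pmfI Suc.IH halves)
  also have "\<dots> = ennreal (c * real (length (take (2 ^ l) xs)) + c * real (length (drop (2 ^ l) xs)))"
    using c by (simp add: ennreal_plus)
  also have "c * real (length (take (2 ^ l) xs)) + c * real (length (drop (2 ^ l) xs)) = c * ?n"
    by (simp add: distrib_left[symmetric] min_def flip: of_nat_add)
  finally have A: "cost orc ?A \<le> ennreal (c * ?n)" .
  have "cost orc (sampler L q (Suc l) xs h) \<le> ennreal ?n + ennreal (2 * ?n) +
      (ennreal e * (ennreal (c * ?n) + ennreal (2 * ?n)) + ennreal (2 * ?n))"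
    using sampler_step(1)[OF assms Suc.prems] A
    by (simp add: e_def ennreal_of_nat_eq_real_of_nat)
      (erule order_trans, intro add_left_mono add_right_mono mult_left_mono, auto)
  also have "\<dots> = ennreal (?n + 2 * ?n + (e * (c * ?n + 2 * ?n) + 2 * ?n))"
  proof -
    have "ennreal x + ennreal y + (ennreal e * (ennreal z + ennreal y) + ennreal y)
        = ennreal (x + y + (e * (z + y) + y))" if "0 \<le> x" "0 \<le> y" "0 \<le> z" for x y z
      using that order_trans[OF zero_le_one e(1)]
      by (simp only: ennreal_plus ennreal_mult add_nonneg_nonneg mult_nonneg_nonneg)
    then show ?thesis using c by simp
  qed
  also have "?n + 2 * ?n + (e * (c * ?n + 2 * ?n) + 2 * ?n) \<le> e ^ Suc l * (9 * real (Suc l) + 1) * ?n"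
  proof -
    have "1 \<le> e ^ Suc l" using e by (intro one_le_power)
    then have "5 + e * (c + 2) \<le> e ^ Suc l * (9 * real (Suc l) + 1)"
      using e by (simp add: c_def algebra_simps)
    from mult_right_mono[OF this, of ?n] show ?thesis by (simp add: algebra_simps)
  qed
  finally show ?case by (simp add: e_def ennreal_leI)
qed

text \<open>\<open>ss\<close> lists the coordinates revealed before the block, so that its random
  prefix has the law \<open>sequential \<pi> ss\<close>. Every inner node of the recursion tree
  contributes; the growth factors are kept apart and appear in
  \<open>excess_sampler\<close>.\<close>

primrec burden :: "nat \<Rightarrow> real \<Rightarrow> nat \<Rightarrow> nat list \<Rightarrow> nat list \<Rightarrow> real" where
  "burden J \<tau> 0 ss xs = 0"
| "burden J \<tau> (Suc l) ss xs =
     8 * (real J * measure_pmf.expectation (sequential \<pi> ss Map.empty)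
       (\<lambda>h. rejection (sequential \<pi> xs h) (factorized \<pi> h xs h)) + \<tau>)
     + (burden J \<tau> l ss (take (2 ^ l) xs) + burden J \<tau> l (ss @ take (2 ^ l) xs) (drop (2 ^ l) xs))"

lemma burden_nonneg: "0 \<le> \<tau> \<Longrightarrow> 0 \<le> burden J \<tau> l ss xs"
  by (induction l arbitrary: ss xs) (auto simp: rejection_nonneg integral_nonneg_AE)

text \<open>Excess is additive over the two halves, and averaging over the prefix turns the second
  half into a block with the longer prefix \<open>ss @ take (2 ^ l) xs\<close>. So the contributions
  of the whole tree are summed, with a factor \<open>1 + 1 / L\<close> per level.\<close>

lemma excess_sampler:
  fixes L J :: nat
  defines "\<tau> \<equiv> (real L + 1) / (1 + 1 / real L) ^ J"
  assumes "0 < L"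
  shows "block (ss @ xs) Map.empty \<Longrightarrow> length xs \<le> 2 ^ l \<Longrightarrow>
    (\<integral>\<^sup>+h. excess orc 3 (sampler L q l xs h) \<partial>sequential \<pi> ss Map.empty)
      \<le> ennreal ((1 + 1 / real L) ^ l * burden J \<tau> l ss xs)"
proof (induction l arbitrary: ss xs)
  case 0
  have "excess orc 3 (draft xs h) = 0" for h
    using excess_antimono[of 1 3 orc "draft xs h"] using excess_draft[of orc xs h] by simp
  then show ?case by simp
next
  case (Suc l)
  define e where "e = 1 + 1 / real L"
  have e: "1 \<le> e" using assms by (simp add: e_def)
  have \<tau>: "0 \<le> \<tau>" by (simp add: \<tau>_def)
  let ?M = "sequential \<pi> ss Map.empty" and ?x = "take (2 ^ l) xs" and ?y = "drop (2 ^ l) xs"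
  let ?t = "\<lambda>h. rejection (sequential \<pi> xs h) (factorized \<pi> h xs h)"
  have fin: "finite (set_pmf ?M)"
    using sequential_extensions[OF block_appendD[OF Suc.prems(1)]] by (rule finite_subset) simp
  have step: "excess orc 3 (sampler L q (Suc l) xs h) \<le> ennreal (8 * (real J * ?t h + \<tau>)) +
     ennreal e * (excess orc 3 (sampler L q l ?x h) +
       (\<integral>\<^sup>+y. excess orc 3 (sampler L q l ?y y) \<partial>sequential \<pi> ?x h))" if "h \<in> set_pmf ?M" for h
  proof -
    have b: "block xs h" using block_append[OF Suc.prems(1)] that .
    note halves = sampler_halves[OF b Suc.prems(2)]
    have "excess orc (3 + 3) (bindp (sampler L q l ?x h) (sampler L q l ?y)) \<le>
       excess orc 3 (sampler L q l ?x h) + (\<integral>\<^sup>+y. excess orc 3 (sampler L q l ?y y) \<partial>sequential \<pi> ?x h)"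
      using excess_bindp[of orc 3 3 "sampler L q l ?x h" "sampler L q l ?y"]
      by (simp only: law_sampler[OF assms(2) halves(1,2)])
    from mult_left_mono[OF this, of "ennreal e"]
    show ?thesis
      using sampler_step(2)[OF assms(2) b Suc.prems(2), of J]
      by (simp add: \<tau>_def e_def) (erule order_trans, rule add_left_mono, assumption)
  qed
  have "(\<integral>\<^sup>+h. excess orc 3 (sampler L q (Suc l) xs h) \<partial>?M)
    \<le> (\<integral>\<^sup>+h. ennreal (8 * (real J * ?t h + \<tau>)) +
     ennreal e * (excess orc 3 (sampler L q l ?x h) +
       (\<integral>\<^sup>+y. excess orc 3 (sampler L q l ?y y) \<partial>sequential \<pi> ?x h)) \<partial>?M)"
    by (intro nn_integral_mono_AE AE_pmfI step)
  also have "\<dots> = (\<integral>\<^sup>+h. ennreal (8 * (real J * ?t h + \<tau>)) \<partial>?M) +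
     ennreal e * ((\<integral>\<^sup>+h. excess orc 3 (sampler L q l ?x h) \<partial>?M) +
       (\<integral>\<^sup>+y. excess orc 3 (sampler L q l ?y y) \<partial>sequential \<pi> (ss @ ?x) Map.empty))"
    by (simp add: nn_integral_add nn_integral_cmult sequential_append)
  also have "\<dots> \<le> ennreal (8 * (real J * measure_pmf.expectation ?M ?t + \<tau>)) +
     ennreal e * (ennreal (e ^ l * burden J \<tau> l ss ?x) + ennreal (e ^ l * burden J \<tau> l (ss @ ?x) ?y))"
  proof (intro add_mono mult_left_mono)
    have "(\<integral>\<^sup>+h. ennreal (8 * (real J * ?t h + \<tau>)) \<partial>?M)
       = ennreal (measure_pmf.expectation ?M (\<lambda>h. 8 * (real J * ?t h + \<tau>)))"
      using fin \<tau> rejection_nonneg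
      by (intro nn_integral_pmf_finite) (auto intro!: mult_nonneg_nonneg add_nonneg_nonneg)
    also have "measure_pmf.expectation ?M (\<lambda>h. 8 * (real J * ?t h + \<tau>))
       = 8 * (real J * measure_pmf.expectation ?M ?t + \<tau>)"
      using fin by (simp add: integrable_measure_pmf_finite)
    finally show "(\<integral>\<^sup>+h. ennreal (8 * (real J * ?t h + \<tau>)) \<partial>?M)
      \<le> ennreal (8 * (real J * measure_pmf.expectation ?M ?t + \<tau>))" by simp
    have "block (ss @ ?x) Map.empty" using Suc.prems(1) block_appendD[of "ss @ ?x" ?y] by simp
    then show "(\<integral>\<^sup>+h. excess orc 3 (sampler L q l ?x h) \<partial>?M) \<le> ennreal (e ^ l * burden J \<tau> l ss ?x)"
      unfolding e_def by (intro Suc.IH) auto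
    show "(\<integral>\<^sup>+y. excess orc 3 (sampler L q l ?y y) \<partial>sequential \<pi> (ss @ ?x) Map.empty)
      \<le> ennreal (e ^ l * burden J \<tau> l (ss @ ?x) ?y)"
      unfolding e_def using Suc.prems by (intro Suc.IH) auto
  qed simp
  also have "\<dots> = ennreal (8 * (real J * measure_pmf.expectation ?M ?t + \<tau>) +
     e * (e ^ l * burden J \<tau> l ss ?x + e ^ l * burden J \<tau> l (ss @ ?x) ?y))"
    using e \<tau> burden_nonneg[OF \<tau>, of J l]
    by (simp add: ennreal_plus ennreal_mult rejection_nonneg integral_nonneg_AE)
  also have "\<dots> \<le> ennreal (e ^ Suc l * burden J \<tau> (Suc l) ss xs)"
  proof (rule ennreal_leI)
    have "0 \<le> 8 * (real J * measure_pmf.expectation ?M ?t + \<tau>)"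
      using \<tau> by (simp add: rejection_nonneg integral_nonneg_AE)
    then have "8 * (real J * measure_pmf.expectation ?M ?t + \<tau>) \<le> e ^ Suc l * (8 * (real J * measure_pmf.expectation ?M ?t + \<tau>))"
      using one_le_power[OF e, of "Suc l"] mult_right_mono by fastforce
    then show "8 * (real J * measure_pmf.expectation ?M ?t + \<tau>) +
     e * (e ^ l * burden J \<tau> l ss ?x + e ^ l * burden J \<tau> l (ss @ ?x) ?y) \<le> e ^ Suc l * burden J \<tau> (Suc l) ss xs"
      by (simp add: algebra_simps)
  qed
  finally show ?case by (simp add: e_def)
qed

end

section \<open>Entropy bounds\<close>

lemma expectation_bind_pmf_finite:
  fixes f :: "'b \<Rightarrow> real"
  assumes "finite (set_pmf M)" "\<And>x. x \<in> set_pmf M \<Longrightarrow> finite (set_pmf (g x))"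
  shows "measure_pmf.expectation (bind_pmf M g) f = measure_pmf.expectation M (\<lambda>x. measure_pmf.expectation (g x) f)"
proof -
  have "measure_pmf.expectation (bind_pmf M g) f
     = (\<Sum>x\<in>set_pmf M. pmf M x *\<^sub>R measure_pmf.expectation (g x) f)"
    using assms by (intro pmf_expectation_bind) auto
  then show ?thesis using assms by (simp add: expectation_pmf_finite[OF assms(1) order.refl])
qed

context
  fixes \<mu> \<nu> :: "'a pmf"
  assumes fin: "finite (set_pmf \<mu>)" and ac: "set_pmf \<mu> \<subseteq> set_pmf \<nu>"
begin

lemma expectation_ratio_le_1:
  "measure_pmf.expectation \<mu> (\<lambda>y. pmf \<nu> y / pmf \<mu> y) \<le> 1"
proof -
  have "measure_pmf.expectation \<mu> (\<lambda>y. pmf \<nu> y / pmf \<mu> y)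
     = (\<Sum>y\<in>set_pmf \<mu>. pmf \<mu> y * (pmf \<nu> y / pmf \<mu> y))"
    by (rule expectation_pmf_finite[OF fin order.refl])
  also have "\<dots> = (\<Sum>y\<in>set_pmf \<mu>. pmf \<nu> y)"
    by (intro sum.cong) (auto simp: set_pmf_iff)
  also have "\<dots> = measure_pmf.prob \<nu> (set_pmf \<mu>)"
    by (rule measure_measure_pmf_finite[OF fin, symmetric])
  finally show ?thesis by simp
qed

lemma ratio_pos:
  assumes "y \<in> set_pmf \<mu>"
  shows "0 < pmf \<nu> y / pmf \<mu> y" "ln (pmf \<mu> y / pmf \<nu> y) = - ln (pmf \<nu> y / pmf \<mu> y)"
  using assms ac by (auto simp: pmf_positive ln_div)

text \<open>Gibbs' inequality, from \<open>ln x \<le> x - 1\<close>.\<close>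

lemma relative_entropy_nonneg:
  "0 \<le> measure_pmf.expectation \<mu> (\<lambda>y. ln (pmf \<mu> y / pmf \<nu> y))"
proof -
  have "1 - measure_pmf.expectation \<mu> (\<lambda>y. pmf \<nu> y / pmf \<mu> y)
     = measure_pmf.expectation \<mu> (\<lambda>y. 1 - pmf \<nu> y / pmf \<mu> y)"
    by (simp add: integrable_measure_pmf_finite fin)
  also have "\<dots> \<le> measure_pmf.expectation \<mu> (\<lambda>y. ln (pmf \<mu> y / pmf \<nu> y))"
  proof (intro integral_mono_AE integrable_measure_pmf_finite fin AE_pmfI)
    fix y assume y: "y \<in> set_pmf \<mu>"
    show "1 - pmf \<nu> y / pmf \<mu> y \<le> ln (pmf \<mu> y / pmf \<nu> y)"
      using ln_le_minus_one[OF ratio_pos(1)[OF y]] ratio_pos(2)[OF y] by simp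
  qed
  finally show ?thesis using expectation_ratio_le_1 by simp
qed

text \<open>A linearized Pinsker inequality, obtained through the Hellinger distance.\<close>

lemma rejection_le_relative_entropy:
  assumes "0 < c"
  shows "rejection \<mu> \<nu> \<le> c + measure_pmf.expectation \<mu> (\<lambda>y. ln (pmf \<mu> y / pmf \<nu> y)) / c"
proof -
  let ?r = "\<lambda>y. pmf \<nu> y / pmf \<mu> y"
  \<comment> \<open>For \<open>u = sqrt r\<close>, the bound \<open>ln u \<le> u - 1\<close> gives
    \<open>(1 - u) ^ 2 \<le> r - 1 - ln r\<close>, and
    \<open>1 - r \<le> 2 * (1 - u) \<le> c + (1 - u) ^ 2 / c\<close> when \<open>u \<le> 1\<close>.
    The additional \<open>r - 1\<close> has expectation at most 0.\<close>
  have pt: "max 0 (1 - r) \<le> c + (r - 1 - ln r) / c" if "0 < r" for r :: real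
  proof -
    define u where "u = sqrt r"
    have u: "0 < u" "r = u\<^sup>2" using that by (auto simp: u_def)
    have "ln r = 2 * ln u" using u by (simp add: ln_realpow)
    then have "(1 - u)\<^sup>2 \<le> r - 1 - ln r"
      using ln_le_minus_one[OF u(1)] by (simp add: u(2) power2_eq_square algebra_simps)
    then have "(1 - u)\<^sup>2 / c \<le> (r - 1 - ln r) / c" using assms by (intro divide_right_mono) auto
    moreover have "max 0 (1 - r) \<le> c + (1 - u)\<^sup>2 / c"
    proof (cases "u \<le> 1")
      case True
      have "0 \<le> (c - (1 - u))\<^sup>2" by simp
      then have "2 * (1 - u) * c \<le> c * c + (1 - u)\<^sup>2" by (simp add: power2_eq_square algebra_simps)
      then have "2 * (1 - u) \<le> c + (1 - u)\<^sup>2 / c" using assms by (simp add: field_simps)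
      moreover have "1 - r \<le> 2 * (1 - u)"
        using zero_le_power2[of "1 - u"] by (simp add: u(2) power2_eq_square algebra_simps)
      ultimately show ?thesis using True assms by (auto simp: max_def)
    next
      case False
      then have "1 \<le> r" using u by (simp add: one_le_power)
      then show ?thesis using assms by simp
    qed
    ultimately show ?thesis by linarith
  qed
  have "rejection \<mu> \<nu> \<le> measure_pmf.expectation \<mu> (\<lambda>y. c + (?r y - 1 + ln (pmf \<mu> y / pmf \<nu> y)) / c)"
    unfolding rejection_def
  proof (intro integral_mono_AE integrable_measure_pmf_finite fin AE_pmfI)
    fix y assume y: "y \<in> set_pmf \<mu>"
    show "max 0 (1 - ?r y) \<le> c + (?r y - 1 + ln (pmf \<mu> y / pmf \<nu> y)) / c"
      using pt[OF ratio_pos(1)[OF y]] ratio_pos(2)[OF y] by simp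
  qed
  also have "\<dots> = c + (measure_pmf.expectation \<mu> ?r - 1
      + measure_pmf.expectation \<mu> (\<lambda>y. ln (pmf \<mu> y / pmf \<nu> y))) / c"
    by (simp add: integrable_measure_pmf_finite fin)
  also have "\<dots> \<le> c + measure_pmf.expectation \<mu> (\<lambda>y. ln (pmf \<mu> y / pmf \<nu> y)) / c"
    using expectation_ratio_le_1 assms by (intro add_left_mono divide_right_mono) auto
  finally show ?thesis .
qed

end

section \<open>Sequential draws as restrictions of one configuration\<close>

lemma extensionsI:
  "distinct xs \<Longrightarrow> (\<And>i. i \<in> set xs \<Longrightarrow> \<exists>a\<in>{1..q}. y i = Some a) \<Longrightarrow> (\<And>j. j \<notin> set xs \<Longrightarrow> y j = h j) \<Longrightarrow>
    y \<in> set (extensions q xs h)"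
proof (induction xs arbitrary: h)
  case Nil
  then have "y = h" by (intro ext) auto
  then show ?case by simp
next
  case (Cons i xs)
  obtain a where a: "a \<in> {1..q}" "y i = Some a" using Cons.prems(2)[of i] by auto
  have "y \<in> set (extensions q xs (h(i \<mapsto> a)))"
    using Cons.prems a by (intro Cons.IH) auto
  then show ?case using a(1) unfolding set_extensions_Cons by blast
qed

lemma extensions_extend:
  assumes "y \<in> set (extensions q xs h)" "set xs \<inter> dom h = {}"
  shows "h \<subseteq>\<^sub>m y"
  unfolding map_le_def
proof
  fix j assume "j \<in> dom h"
  then have "j \<notin> set xs" using assms(2) by auto
  from extensions_agree[OF assms(1) this] show "h j = y j" by simp
qed

lemma extensions_Some:
  "y \<in> set (extensions q xs h) \<Longrightarrow> i \<in> set xs \<Longrightarrow> y i \<noteq> None"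
proof (induction xs arbitrary: h)
  case (Cons j xs)
  then obtain a where a: "y \<in> set (extensions q xs (h(j \<mapsto> a)))"
    unfolding set_extensions_Cons by blast
  show ?case
  proof (cases "i \<in> set xs")
    case False
    then show ?thesis using Cons.prems extensions_agree[OF a False] by auto
  qed (use Cons.IH a in auto)
qed simp

context conditional_queries
begin

lemma P_mono: "h \<subseteq>\<^sub>m y \<Longrightarrow> P y \<le> P h"
  unfolding agreeing_def by (intro measure_pmf.finite_measure_mono) (auto intro: map_le_trans)

text \<open>The conditional probabilities along the chain telescope; a null prefix forces
  \<open>P y = 0\<close>.\<close>

lemma pmf_sequential:
  "block xs h \<Longrightarrow> y \<in> set (extensions q xs h) \<Longrightarrow> pmf (sequential \<pi> xs h) y = P y / P h"
proof (induction xs arbitrary: h)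
  case Nil
  then show ?case by (auto simp: block_def possible_def)
next
  case (Cons i xs)
  obtain a where a: "y \<in> set (extensions q xs (h(i \<mapsto> a)))"
    using Cons.prems(2) unfolding set_extensions_Cons by blast
  have i: "i \<notin> set xs" and i': "i \<in> {1..n} - dom h" and h: "P h > 0"
    using Cons.prems(1) by (auto simp: block_def possible_def)
  have yi: "y i = Some a" using extensions_agree[OF a i] by simp
  have eq: "pmf (sequential \<pi> (i # xs) h) y = P (h(i \<mapsto> a)) / P h * pmf (sequential \<pi> xs (h(i \<mapsto> a))) y"
    using pmf_sequential_Cons[where y = y, OF i yi] pmf_cond_marginal[OF h i'] by simp
  show ?case
  proof (cases "P (h(i \<mapsto> a)) = 0")
    case True
    have "h(i \<mapsto> a) \<subseteq>\<^sub>m y"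
      using Cons.prems(1) by (intro extensions_extend[OF a]) (auto simp: block_def)
    then show ?thesis using eq True P_mono[of "h(i \<mapsto> a)" y] measure_nonneg[of \<pi> "agreeing y"] by simp
  next
    case False
    then have "a \<in> set_pmf (cond_marginal \<pi> i h)"
      using pmf_cond_marginal[OF h i'] h by (simp add: set_pmf_iff)
    have "pmf (sequential \<pi> xs (h(i \<mapsto> a))) y = P y / P (h(i \<mapsto> a))"
      by (rule Cons.IH[OF block_update[OF Cons.prems(1) \<open>a \<in> _\<close>] a])
    then show ?thesis using eq False by simp
  qed
qed

lemma pmf_factorized:
  "block xs h \<Longrightarrow> y \<in> set (extensions q xs g) \<Longrightarrow>
    pmf (factorized \<pi> h xs g) y = (\<Prod>i\<in>set xs. P (h(i := y i)) / P h)"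
proof (induction xs arbitrary: g)
  case (Cons i xs)
  obtain a where a: "y \<in> set (extensions q xs (g(i \<mapsto> a)))"
    using Cons.prems(2) unfolding set_extensions_Cons by blast
  have i: "i \<notin> set xs" and i': "i \<in> {1..n} - dom h" and h: "P h > 0" and b: "block xs h"
    using Cons.prems(1) by (auto simp: block_def possible_def)
  have yi: "y i = Some a" using extensions_agree[OF a i] by simp
  have IH: "pmf (factorized \<pi> h xs (g(i \<mapsto> a))) y = (\<Prod>i\<in>set xs. P (h(i := y i)) / P h)"
    by (rule Cons.IH[OF b a])
  show ?case
    unfolding pmf_factorized_Cons[where y = y, OF i yi] pmf_cond_marginal[OF h i'] IH
    by (simp only: list.set prod.insert[OF finite_set i] yi)
qed simp

lemma restrict_extensions:
  assumes "X \<in> set_pmf \<pi>" "distinct ss" "set ss \<subseteq> {1..n}"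
  shows "X |` set ss \<in> set (extensions q ss Map.empty)"
proof (rule extensionsI[OF assms(2)])
  fix i assume "i \<in> set ss"
  moreover then have "i \<in> dom X" using support[OF assms(1)] assms(3) by auto
  then obtain a where "X i = Some a" by auto
  moreover then have "a \<in> {1..q}" using support[OF assms(1)] by (auto simp: ran_def)
  ultimately show "\<exists>a\<in>{1..q}. (X |` set ss) i = Some a" by auto
qed auto

lemma block_empty_iff: "block ss Map.empty \<longleftrightarrow> distinct ss \<and> set ss \<subseteq> {1..n}"
  by (auto simp: block_def possible_empty)

text \<open>Both sides give mass \<open>P y\<close> to every extension. So the law of the revealed
  values depends only on the set of coordinates, and averages over prefixes become averages under
  \<open>\<pi>\<close>.\<close>

lemma sequential_restrict:
  assumes "block ss Map.empty"
  shows "sequential \<pi> ss Map.empty = map_pmf (\<lambda>X. X |` set ss) \<pi>"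
proof (rule pmf_eqI)
  fix y
  have ss: "distinct ss" "set ss \<subseteq> {1..n}" using assms by (auto simp: block_empty_iff)
  show "pmf (sequential \<pi> ss Map.empty) y = pmf (map_pmf (\<lambda>X. X |` set ss) \<pi>) y"
  proof (cases "y \<in> set (extensions q ss Map.empty)")
    case True
    have y: "y i = None \<longleftrightarrow> i \<notin> set ss" for i
      using extensions_Some[OF True, of i] extensions_agree[OF True, of i] by auto
    have iff: "X |` set ss = y \<longleftrightarrow> y \<subseteq>\<^sub>m X" for X
    proof
      assume "y \<subseteq>\<^sub>m X"
      then have "(X |` set ss) i = y i" for i
        using y[of i] by (cases "i \<in> set ss") (auto simp: map_le_def dom_def)
      then show "X |` set ss = y" by auto
    qed (auto simp: map_le_def restrict_map_def split: if_splits)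
    have "pmf (map_pmf (\<lambda>X. X |` set ss) \<pi>) y = P y"
      unfolding pmf_map agreeing_def vimage_def by (simp add: iff)
    then show ?thesis using pmf_sequential[OF assms True] P_empty by simp
  next
    case False
    then have "y \<notin> set_pmf (sequential \<pi> ss Map.empty)" using sequential_extensions[OF assms] by auto
    moreover have "y \<notin> set_pmf (map_pmf (\<lambda>X. X |` set ss) \<pi>)"
      using False restrict_extensions[OF _ ss] by auto
    ultimately show ?thesis by (simp only: set_pmf_iff not_not)
  qed
qed

lemma sequential_full:
  assumes "block \<sigma> Map.empty" "set \<sigma> = {1..n}"
  shows "sequential \<pi> \<sigma> Map.empty = \<pi>"
proof -
  have "map_pmf (\<lambda>X. X |` set \<sigma>) \<pi> = \<pi>"
  proof (rule map_pmf_idI)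
    fix X assume "X \<in> set_pmf \<pi>"
    then have "X i = None" if "i \<notin> set \<sigma>" for i
      using assms(2) support[of X] that by (auto simp only: domIff)
    then show "X |` set \<sigma> = X" by (intro ext) (simp add: restrict_map_def)
  qed
  then show ?thesis using sequential_restrict[OF assms(1)] by simp
qed

section \<open>Entropies of sets of coordinates\<close>

lemma finite_support: "finite (set_pmf \<pi>)"
proof -
  have "set_pmf (sequential \<pi> [1..<Suc n] Map.empty) = set_pmf \<pi>"
    by (subst sequential_full) (auto simp: block_empty_iff simp del: upt_Suc)
  moreover have "finite (set_pmf (sequential \<pi> [1..<Suc n] Map.empty))"
    using sequential_extensions[of "[1..<Suc n]" Map.empty]
    by (rule finite_subset) (auto simp: block_empty_iff simp del: upt_Suc)
  ultimately show ?thesis by simp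
qed

lemma finite_sequential: "block xs h \<Longrightarrow> finite (set_pmf (sequential \<pi> xs h))"
  using sequential_extensions by (rule finite_subset) auto

text \<open>Shannon entropy, in natural units, of the coordinates in \<open>S\<close>: the mass
  inside the logarithm is that of the values of \<open>X\<close> on \<open>S\<close>. Then
  \<open>cond_entropy\<close> is the conditional entropy of one coordinate, defined through the
  chain rule.\<close>

definition entropy :: "nat set \<Rightarrow> real" where
  "entropy S = measure_pmf.expectation \<pi> (\<lambda>X. - ln (P (X |` S)))"

definition cond_entropy :: "nat set \<Rightarrow> nat \<Rightarrow> real" where
  "cond_entropy S i = entropy (insert i S) - entropy S"

lemma P_restrict_pos: "X \<in> set_pmf \<pi> \<Longrightarrow> 0 < P (X |` S)"
  by (rule measure_pmf_posI) (auto simp: agreeing_def map_le_def)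

text \<open>The event of \<open>y\<close> lies in each event that fixes just one further coordinate,
  so no factor vanishes. This is the absolute continuity that the relative entropy bounds
  require.\<close>

lemma factorized_support:
  assumes "block xs h"
  shows "set_pmf (sequential \<pi> xs h) \<subseteq> set_pmf (factorized \<pi> h xs h)"
proof
  fix y assume y: "y \<in> set_pmf (sequential \<pi> xs h)"
  have ext: "y \<in> set (extensions q xs h)" using sequential_extensions[OF assms] y by auto
  have h: "P h > 0" using assms by (simp add: block_def possible_def)
  have "pmf (sequential \<pi> xs h) y > 0" using y by (rule pmf_positive)
  then have Py: "P y > 0"
    unfolding pmf_sequential[OF assms ext] using h by (simp add: zero_less_divide_iff)
  have "P (h(i := y i)) > 0" for i
  proof -
    have "h(i := y i) \<subseteq>\<^sub>m y"
      using extensions_extend[OF ext] assms by (auto simp: map_le_def block_def)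
    from P_mono[OF this] Py show ?thesis by linarith
  qed
  then have "pmf (factorized \<pi> h xs h) y > 0"
    unfolding pmf_factorized[OF assms ext] using h by (intro prod_pos) auto
  then show "y \<in> set_pmf (factorized \<pi> h xs h)" by (simp add: set_pmf_iff)
qed

text \<open>This is the conditional total correlation of the block: the log-ratio splits into
  logarithms of masses, and each of them averages to an entropy.\<close>

lemma expected_relative_entropy:
  assumes "block (ss @ xs) Map.empty"
  shows "measure_pmf.expectation (sequential \<pi> ss Map.empty) (\<lambda>h. measure_pmf.expectation (sequential \<pi> xs h)
      (\<lambda>y. ln (pmf (sequential \<pi> xs h) y / pmf (factorized \<pi> h xs h) y)))
    = (\<Sum>i\<in>set xs. cond_entropy (set ss) i) - (entropy (set ss \<union> set xs) - entropy (set ss))"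
proof -
  let ?M = "sequential \<pi> ss Map.empty"
  have b: "distinct ss" "distinct xs" "set ss \<inter> set xs = {}" "set (ss @ xs) \<subseteq> {1..n}" and
    bs: "block ss Map.empty" using assms by (auto simp: block_empty_iff)
  \<comment> \<open>\<open>y\<close> determines its prefix, so the log-ratio becomes a function of
    \<open>y\<close> alone and the iterated expectation one under \<open>\<pi>\<close>.\<close>
  define F where "F h y = ln (P y) - ln (P h) - (\<Sum>i\<in>set xs. ln (P (h(i := y i))) - ln (P h))" for h y
  have 1: "ln (pmf (sequential \<pi> xs h) y / pmf (factorized \<pi> h xs h) y) = F (y |` set ss) y"
    if hy: "h \<in> set_pmf ?M" "y \<in> set_pmf (sequential \<pi> xs h)" for h y
  proof -
    have bl: "block xs h" by (rule block_append[OF assms hy(1)])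
    have ext: "y \<in> set (extensions q xs h)" using sequential_extensions[OF bl] hy by auto
    have exth: "h \<in> set (extensions q ss Map.empty)" using sequential_extensions[OF bs] hy by auto
    have h: "P h > 0" using bl by (simp add: block_def possible_def)
    have "(y |` set ss) i = h i" for i
      using extensions_agree[OF ext, of i] extensions_agree[OF exth, of i] b(3)
      by (cases "i \<in> set ss") auto
    then have yh: "y |` set ss = h" by auto
    have "pmf (factorized \<pi> h xs h) y > 0" "pmf (sequential \<pi> xs h) y > 0"
      using hy factorized_support[OF bl] by (auto intro!: pmf_positive)
    then have "P y / P h > 0" and pos: "(\<Prod>i\<in>set xs. P (h(i := y i)) / P h) > 0"
      unfolding pmf_sequential[OF bl ext] pmf_factorized[OF bl ext] by auto
    then have Py: "P y > 0" using h by (simp add: zero_less_divide_iff)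
    have Pi: "P (h(i := y i)) > 0" if "i \<in> set xs" for i
    proof -
      have "(\<Prod>i\<in>set xs. P (h(i := y i)) / P h) \<noteq> 0" using pos by linarith
      then have "P (h(i := y i)) \<noteq> 0" using that by (auto simp: prod_zero_iff)
      then show ?thesis by (simp add: less_le)
    qed
    have "ln (pmf (sequential \<pi> xs h) y / pmf (factorized \<pi> h xs h) y)
      = ln (P y / P h) - ln (\<Prod>i\<in>set xs. P (h(i := y i)) / P h)"
      unfolding pmf_sequential[OF bl ext] pmf_factorized[OF bl ext] using \<open>P y / P h > 0\<close> pos
      by (subst ln_div) (simp only: less_irrefl if_True simp_thms less_imp_neq[symmetric])
    also have "ln (\<Prod>i\<in>set xs. P (h(i := y i)) / P h) = (\<Sum>i\<in>set xs. ln (P (h(i := y i)) / P h))"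
      using Pi h by (intro ln_prod) (auto simp: less_le)
    also have "\<dots> = (\<Sum>i\<in>set xs. ln (P (h(i := y i))) - ln (P h))"
      using Pi h by (intro sum.cong refl) (simp add: ln_div less_imp_neq[symmetric])
    also have "ln (P y / P h) = ln (P y) - ln (P h)" using Py h by (simp add: ln_div)
    finally show ?thesis unfolding F_def yh .
  qed
  have "measure_pmf.expectation ?M (\<lambda>h. measure_pmf.expectation (sequential \<pi> xs h)
      (\<lambda>y. ln (pmf (sequential \<pi> xs h) y / pmf (factorized \<pi> h xs h) y)))
    = measure_pmf.expectation ?M (\<lambda>h. measure_pmf.expectation (sequential \<pi> xs h) (\<lambda>y. F (y |` set ss) y))"
    using 1 by (intro integral_cong_AE AE_pmfI) auto
  also have "\<dots> = measure_pmf.expectation (sequential \<pi> (ss @ xs) Map.empty) (\<lambda>y. F (y |` set ss) y)"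
    unfolding sequential_append
    by (rule expectation_bind_pmf_finite[symmetric])
      (auto intro: finite_sequential bs block_append[OF assms])
  also have "\<dots> = measure_pmf.expectation \<pi> (\<lambda>X. F (X |` set ss) (X |` (set ss \<union> set xs)))"
    unfolding sequential_restrict[OF assms] by (simp add: Int_absorb1 Un_Int_distrib2 inf_sup_absorb Int_Un_distrib)
  also have "\<dots> = measure_pmf.expectation \<pi> (\<lambda>X. ln (P (X |` (set ss \<union> set xs))) - ln (P (X |` set ss))
      - (\<Sum>i\<in>set xs. ln (P (X |` insert i (set ss))) - ln (P (X |` set ss))))"
  proof -
    have *: "(X |` set ss)(i := (X |` (set ss \<union> set xs)) i) = X |` insert i (set ss)" if "i \<in> set xs" for X i
      using that by (auto simp: restrict_map_def)
    have "(\<Sum>i\<in>set xs. ln (P ((X |` set ss)(i := (X |` (set ss \<union> set xs)) i))) - ln (P (X |` set ss)))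
        = (\<Sum>i\<in>set xs. ln (P (X |` insert i (set ss))) - ln (P (X |` set ss)))" for X
      by (intro sum.cong refl) (subst *, assumption, rule refl)
    then show ?thesis unfolding F_def by (simp only:)
  qed
  also have "\<dots> = (\<Sum>i\<in>set xs. cond_entropy (set ss) i) - (entropy (set ss \<union> set xs) - entropy (set ss))"
    by (simp add: entropy_def cond_entropy_def integrable_measure_pmf_finite finite_support sum_subtractf)
  finally show ?thesis .
qed

text \<open>Subadditivity of conditional entropy is the nonnegativity of the averaged relative
  entropy.\<close>

lemma entropy_union_le:
  assumes "block (ss @ xs) Map.empty"
  shows "entropy (set ss \<union> set xs) - entropy (set ss) \<le> (\<Sum>i\<in>set xs. cond_entropy (set ss) i)"
proof -
  have "0 \<le> measure_pmf.expectation (sequential \<pi> ss Map.empty) (\<lambda>h. measure_pmf.expectation (sequential \<pi> xs h)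
      (\<lambda>y. ln (pmf (sequential \<pi> xs h) y / pmf (factorized \<pi> h xs h) y)))"
    by (intro integral_nonneg_AE AE_pmfI relative_entropy_nonneg finite_sequential factorized_support
        block_append[OF assms])
  then show ?thesis using expected_relative_entropy[OF assms] by simp
qed

text \<open>Being linear in the relative entropy, the Pinsker bound with a fixed \<open>c\<close>
  can be averaged over the prefixes.\<close>

lemma expected_rejection_le:
  assumes "block (ss @ xs) Map.empty" "0 < c"
  shows "measure_pmf.expectation (sequential \<pi> ss Map.empty)
       (\<lambda>h. rejection (sequential \<pi> xs h) (factorized \<pi> h xs h))
    \<le> c + ((\<Sum>i\<in>set xs. cond_entropy (set ss) i) - (entropy (set ss \<union> set xs) - entropy (set ss))) / c"
proof -
  have fin: "finite (set_pmf (sequential \<pi> ss Map.empty))"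
    by (rule finite_sequential[OF block_appendD[OF assms(1)]])
  have "measure_pmf.expectation (sequential \<pi> ss Map.empty)
       (\<lambda>h. rejection (sequential \<pi> xs h) (factorized \<pi> h xs h))
    \<le> measure_pmf.expectation (sequential \<pi> ss Map.empty) (\<lambda>h. c + measure_pmf.expectation (sequential \<pi> xs h)
      (\<lambda>y. ln (pmf (sequential \<pi> xs h) y / pmf (factorized \<pi> h xs h) y)) / c)"
    by (intro integral_mono_AE integrable_measure_pmf_finite fin AE_pmfI rejection_le_relative_entropy
        finite_sequential factorized_support block_append[OF assms(1)] assms(2))
  also have "\<dots> = c + measure_pmf.expectation (sequential \<pi> ss Map.empty) (\<lambda>h. measure_pmf.expectation (sequential \<pi> xs h)
      (\<lambda>y. ln (pmf (sequential \<pi> xs h) y / pmf (factorized \<pi> h xs h) y))) / c"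
    by (simp add: integrable_measure_pmf_finite fin)
  finally show ?thesis unfolding expected_relative_entropy[OF assms(1)] .
qed

lemma cond_entropy_nonneg: "0 \<le> cond_entropy S i"
proof -
  have "entropy S \<le> entropy (insert i S)"
    unfolding entropy_def
  proof (intro integral_mono_AE integrable_measure_pmf_finite finite_support AE_pmfI)
    fix X assume X: "X \<in> set_pmf \<pi>"
    have "P (X |` insert i S) \<le> P (X |` S)" by (rule P_mono) (auto simp: map_le_def restrict_map_def)
    then show "- ln (P (X |` S)) \<le> - ln (P (X |` insert i S))"
      using P_restrict_pos[OF X] by simp
  qed
  then show ?thesis by (simp add: cond_entropy_def)
qed

text \<open>Conditioning reduces entropy: subadditivity for the block of \<open>j\<close> and
  \<open>i\<close>, where the term of \<open>j\<close> cancels.\<close>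

lemma cond_entropy_insert_le:
  assumes "distinct (ss @ [j, i])" "set (ss @ [j, i]) \<subseteq> {1..n}"
  shows "cond_entropy (insert j (set ss)) i \<le> cond_entropy (set ss) i"
  using entropy_union_le[of ss "[j, i]"] assms
  by (simp add: block_empty_iff cond_entropy_def insert_commute)

text \<open>Gibbs' inequality against the uniform distribution on the \<open>q\<close> values of
  coordinate \<open>i\<close>.\<close>

lemma entropy_singleton_le:
  assumes "i \<in> {1..n}"
  shows "cond_entropy {} i \<le> ln (real q)"
proof -
  let ?E = "set (extensions q [i] Map.empty)"
  have b: "block [i] Map.empty" using assms by (simp add: block_empty_iff)
  have eq: "sequential \<pi> [i] Map.empty = map_pmf (\<lambda>X. X |` {i}) \<pi>"
    using sequential_restrict[OF b] by simp
  note sub = sequential_extensions[OF b]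
  have ne: "?E \<noteq> {}" using sub set_pmf_not_empty[of "sequential \<pi> [i] Map.empty"] by auto
  have len: "length (extensions q [i] Map.empty) = q" by (simp add: length_concat o_def sum_list_triv del: upt_Suc)
  have card: "card ?E = q" using distinct_card[OF distinct_extensions[of "[i]" q Map.empty]] len by simp
  have q: "0 < q" using ne card by (metis card_gt_0_iff finite_set)
  have "0 \<le> measure_pmf.expectation (sequential \<pi> [i] Map.empty)
    (\<lambda>y. ln (pmf (sequential \<pi> [i] Map.empty) y / pmf (pmf_of_set ?E) y))"
    using sub ne by (intro relative_entropy_nonneg finite_sequential b) auto
  also have "\<dots> = measure_pmf.expectation (sequential \<pi> [i] Map.empty) (\<lambda>y. ln (P y) + ln (real q))"
  proof (intro integral_cong_AE AE_pmfI)
    fix y assume y: "y \<in> set_pmf (sequential \<pi> [i] Map.empty)"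
    then have ext: "y \<in> ?E" using sub by auto
    have "pmf (sequential \<pi> [i] Map.empty) y = P y" using pmf_sequential[OF b ext] P_empty by simp
    moreover have "pmf (pmf_of_set ?E) y = 1 / real q" using ext ne card by (subst pmf_of_set) auto
    moreover have "P y > 0" using y pmf_positive[OF y] calculation(1) by simp
    ultimately show "ln (pmf (sequential \<pi> [i] Map.empty) y / pmf (pmf_of_set ?E) y) = ln (P y) + ln (real q)"
      using q by (simp add: ln_mult)
  qed auto
  also have "\<dots> = - entropy {i} + ln (real q)"
    unfolding eq by (simp add: entropy_def integrable_measure_pmf_finite finite_support)
  finally show ?thesis by (simp add: cond_entropy_def entropy_def P_empty)
qed

end

section \<open>Averaging over random orders\<close>

lemma take_drop_conv_map:
  "take m (drop a xs) = map ((!) xs) [a..<min (length xs) (a + m)]"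
  by (rule nth_equalityI) auto

context conditional_queries
begin

abbreviation orders :: "nat list set" where
  "orders \<equiv> permutations_of_set {1..n}"

definition average :: "(nat list \<Rightarrow> real) \<Rightarrow> real" where
  "average F = (\<Sum>\<sigma>\<in>orders. F \<sigma>) / fact n"

lemma average_mono: "(\<And>\<sigma>. \<sigma> \<in> orders \<Longrightarrow> F \<sigma> \<le> G \<sigma>) \<Longrightarrow> average F \<le> average G"
  unfolding average_def by (intro divide_right_mono sum_mono) auto

lemma average_add: "average (\<lambda>\<sigma>. F \<sigma> + G \<sigma>) = average F + average G"
  by (simp add: average_def sum.distrib add_divide_distrib)

lemma average_cmult: "average (\<lambda>\<sigma>. c * F \<sigma>) = c * average F"
  by (simp add: average_def sum_distrib_left)

lemma average_divide: "average (\<lambda>\<sigma>. F \<sigma> / c) = average F / c"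
  by (simp add: average_def sum_divide_distrib[symmetric])

lemma average_diff: "average (\<lambda>\<sigma>. F \<sigma> - G \<sigma>) = average F - average G"
  by (simp add: average_def sum_subtractf diff_divide_distrib)

lemma average_sum: "average (\<lambda>\<sigma>. \<Sum>j\<in>I. F \<sigma> j) = (\<Sum>j\<in>I. average (\<lambda>\<sigma>. F \<sigma> j))"
  unfolding average_def by (subst sum.swap) (simp add: sum_divide_distrib)

lemma average_const: "average (\<lambda>\<sigma>. c) = c"
  by (simp add: average_def)

lemma ordersD:
  assumes "\<sigma> \<in> orders"
  shows "set \<sigma> = {1..n}" "distinct \<sigma>" "length \<sigma> = n"
proof -
  show 1: "set \<sigma> = {1..n}" "distinct \<sigma>" using assms by (auto simp: permutations_of_set_def)
  show "length \<sigma> = n" using distinct_card[OF 1(2)] 1(1) by simp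
qed

text \<open>The average entropy of the next coordinate after \<open>k\<close> revealed ones. The
  value 0 from \<open>n\<close> on is needed since nominal block lengths are powers of two and may
  reach beyond \<open>n\<close>.\<close>

definition step_entropy :: "nat \<Rightarrow> real" where
  "step_entropy k = (if k < n then average (\<lambda>\<sigma>. cond_entropy (set (take k \<sigma>)) (\<sigma> ! k)) else 0)"

text \<open>Exchanging positions \<open>a\<close> and \<open>i\<close> is an involution on orders
  that leaves the first \<open>a\<close> entries alone, so all later positions play the same
  role.\<close>

lemma average_cond_entropy:
  assumes "a \<le> i" "i < n"
  shows "average (\<lambda>\<sigma>. cond_entropy (set (take a \<sigma>)) (\<sigma> ! i)) = step_entropy a"
proof -
  define f where "f \<sigma> = \<sigma>[a := \<sigma> ! i, i := \<sigma> ! a]" for \<sigma> :: "nat list"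
  have f: "f \<sigma> \<in> orders" "f (f \<sigma>) = \<sigma>" "take a (f \<sigma>) = take a \<sigma>" "f \<sigma> ! a = \<sigma> ! i"
    if "\<sigma> \<in> orders" for \<sigma>
  proof -
    note s = ordersD[OF that]
    show "f \<sigma> \<in> orders"
      using s assms by (auto simp: permutations_of_set_def f_def)
    show "f (f \<sigma>) = \<sigma>"
      using s assms by (intro nth_equalityI) (auto simp: f_def nth_list_update)
    show "take a (f \<sigma>) = take a \<sigma>" using assms by (simp add: f_def)
    show "f \<sigma> ! a = \<sigma> ! i" using s assms by (simp add: f_def nth_list_update)
  qed
  have "(\<Sum>\<sigma>\<in>orders. cond_entropy (set (take a \<sigma>)) (\<sigma> ! i))
     = (\<Sum>\<sigma>\<in>orders. cond_entropy (set (take a \<sigma>)) (\<sigma> ! a))"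
    by (rule sum.reindex_bij_witness[of _ f f]) (simp_all add: f del: One_nat_def)
  then show ?thesis using assms by (simp add: average_def step_entropy_def)
qed

lemma step_entropy_nonneg: "0 \<le> step_entropy k"
  by (auto simp: step_entropy_def average_def intro!: divide_nonneg_nonneg sum_nonneg cond_entropy_nonneg)

lemma step_entropy_0: "0 < n \<Longrightarrow> step_entropy 0 \<le> ln (real q)"
proof -
  assume n: "0 < n"
  have "average (\<lambda>\<sigma>. cond_entropy {} (\<sigma> ! 0)) \<le> average (\<lambda>\<sigma>. ln (real q))"
  proof (intro average_mono entropy_singleton_le)
    fix \<sigma> assume "\<sigma> \<in> orders"
    then show "\<sigma> ! 0 \<in> {1..n}" using ordersD[of \<sigma>] n nth_mem[of 0 \<sigma>] by auto
  qed
  then show ?thesis using n by (simp add: step_entropy_def average_const)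
qed

text \<open>Revealing one more coordinate does not raise the entropy of
  \<open>\<sigma> ! Suc k\<close>, which given the first \<open>k\<close> has by symmetry the same
  average as that of \<open>\<sigma> ! k\<close>. At the end, the claim is just
  nonnegativity.\<close>

lemma step_entropy_Suc: "step_entropy (Suc k) \<le> step_entropy k"
proof (cases "Suc k < n")
  case True
  have "step_entropy (Suc k) \<le> average (\<lambda>\<sigma>. cond_entropy (set (take k \<sigma>)) (\<sigma> ! Suc k))"
    unfolding step_entropy_def if_P[OF True]
  proof (rule average_mono)
    fix \<sigma> assume "\<sigma> \<in> orders"
    note s = ordersD[OF this]
    have t: "take (Suc (Suc k)) \<sigma> = take k \<sigma> @ [\<sigma> ! k, \<sigma> ! Suc k]"
      using True s by (simp add: take_Suc_conv_app_nth)
    have "set (take (Suc k) \<sigma>) = insert (\<sigma> ! k) (set (take k \<sigma>))"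
      using True s by (simp add: take_Suc_conv_app_nth)
    moreover have "cond_entropy (insert (\<sigma> ! k) (set (take k \<sigma>))) (\<sigma> ! Suc k)
        \<le> cond_entropy (set (take k \<sigma>)) (\<sigma> ! Suc k)"
      using s set_take_subset[of "Suc (Suc k)" \<sigma>]
      by (intro cond_entropy_insert_le) (simp_all only: t[symmetric] distinct_take)
    ultimately show "cond_entropy (set (take (Suc k) \<sigma>)) (\<sigma> ! Suc k)
        \<le> cond_entropy (set (take k \<sigma>)) (\<sigma> ! Suc k)" by simp
  qed
  then show ?thesis using average_cond_entropy[of k "Suc k"] True by simp
next
  case False
  then show ?thesis using step_entropy_nonneg[of k] by (simp add: step_entropy_def[of "Suc k"])
qed

lemma step_entropy_antimono: "i \<le> j \<Longrightarrow> step_entropy j \<le> step_entropy i"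
  by (rule lift_Suc_antimono_le[of step_entropy]) (auto intro: step_entropy_Suc)

lemma entropy_chain:
  assumes "a \<le> b" "b \<le> length \<sigma>"
  shows "entropy (set (take b \<sigma>)) - entropy (set (take a \<sigma>))
    = (\<Sum>j\<in>{a..<b}. cond_entropy (set (take j \<sigma>)) (\<sigma> ! j))"
proof -
  have "(\<Sum>j\<in>{a..<b}. cond_entropy (set (take j \<sigma>)) (\<sigma> ! j))
     = (\<Sum>j\<in>{a..<b}. entropy (set (take (Suc j) \<sigma>)) - entropy (set (take j \<sigma>)))"
    using assms by (intro sum.cong refl) (simp add: cond_entropy_def take_Suc_conv_app_nth)
  then show ?thesis using sum_Suc_diff'[OF assms(1), of "\<lambda>j. entropy (set (take j \<sigma>))"] by simp
qed

text \<open>By the chain rule the total correlation of a block sums, over its positions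
  \<open>j\<close>, the entropy of \<open>\<sigma> ! j\<close> given the prefix of the block minus
  that given everything before \<open>j\<close>. On average this is
  \<open>step_entropy a - step_entropy j\<close>, at most the drop over the whole block.\<close>

lemma average_rejection_le:
  assumes "0 < c"
  shows "average (\<lambda>\<sigma>. measure_pmf.expectation (sequential \<pi> (take a \<sigma>) Map.empty)
      (\<lambda>h. rejection (sequential \<pi> (take m (drop a \<sigma>)) h) (factorized \<pi> h (take m (drop a \<sigma>)) h)))
    \<le> c + real m * (step_entropy a - step_entropy (a + m)) / c"
proof -
  \<comment> \<open>The last blocks of an order may be cut short or empty; \<open>{a..<b}\<close>
    holds the positions that exist.\<close>
  define b where "b = min n (a + m)"
  have "average (\<lambda>\<sigma>. measure_pmf.expectation (sequential \<pi> (take a \<sigma>) Map.empty)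
      (\<lambda>h. rejection (sequential \<pi> (take m (drop a \<sigma>)) h) (factorized \<pi> h (take m (drop a \<sigma>)) h)))
    \<le> average (\<lambda>\<sigma>. c + (\<Sum>j\<in>{a..<b}. cond_entropy (set (take a \<sigma>)) (\<sigma> ! j)
        - cond_entropy (set (take j \<sigma>)) (\<sigma> ! j)) / c)"
  proof (rule average_mono)
    fix \<sigma> assume "\<sigma> \<in> orders"
    note s = ordersD[OF this]
    let ?x = "take m (drop a \<sigma>)"
    have app: "take a \<sigma> @ ?x = take (a + m) \<sigma>" by (simp add: take_add)
    have bl: "block (take a \<sigma> @ ?x) Map.empty"
      unfolding app block_empty_iff using s set_take_subset[of "a + m" \<sigma>] by (simp add: distinct_take)
    have "(\<Sum>i\<in>set ?x. cond_entropy (set (take a \<sigma>)) i) = (\<Sum>i\<leftarrow>?x. cond_entropy (set (take a \<sigma>)) i)"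
      using s by (simp add: sum_list_distinct_conv_sum_set)
    also have "\<dots> = (\<Sum>j\<in>{a..<b}. cond_entropy (set (take a \<sigma>)) (\<sigma> ! j))"
      using s by (simp add: take_drop_conv_map o_def interv_sum_list_conv_sum_set_nat b_def)
    finally have 1: "(\<Sum>i\<in>set ?x. cond_entropy (set (take a \<sigma>)) i)
        = (\<Sum>j\<in>{a..<b}. cond_entropy (set (take a \<sigma>)) (\<sigma> ! j))" .
    have 2: "entropy (set (take a \<sigma>) \<union> set ?x) - entropy (set (take a \<sigma>))
        = (\<Sum>j\<in>{a..<b}. cond_entropy (set (take j \<sigma>)) (\<sigma> ! j))"
    proof (cases "a \<le> n")
      case True
      have "set (take a \<sigma>) \<union> set ?x = set (take b \<sigma>)"
        unfolding set_append[symmetric] app using s by (simp add: b_def min_def)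
      then show ?thesis using entropy_chain[of a b \<sigma>] True s by (simp add: b_def)
    qed (use s in \<open>simp add: b_def\<close>)
    show "measure_pmf.expectation (sequential \<pi> (take a \<sigma>) Map.empty)
      (\<lambda>h. rejection (sequential \<pi> ?x h) (factorized \<pi> h ?x h))
      \<le> c + (\<Sum>j\<in>{a..<b}. cond_entropy (set (take a \<sigma>)) (\<sigma> ! j)
        - cond_entropy (set (take j \<sigma>)) (\<sigma> ! j)) / c"
      using expected_rejection_le[OF bl assms] unfolding 1 2 sum_subtractf .
  qed
  also have "\<dots> = c + (\<Sum>j\<in>{a..<b}. step_entropy a - step_entropy j) / c"
    unfolding average_add average_const average_divide average_sum average_diff
    by (intro arg_cong2[where f = "(+)"] arg_cong2[where f = "(/)"] sum.cong refl arg_cong2[where f = "(-)"]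
        average_cond_entropy) (auto simp: b_def)
  also have "\<dots> \<le> c + real m * (step_entropy a - step_entropy (a + m)) / c"
  proof -
    have "(\<Sum>j\<in>{a..<b}. step_entropy a - step_entropy j) \<le> (\<Sum>j\<in>{a..<b}. step_entropy a - step_entropy (a + m))"
      by (intro sum_mono diff_left_mono step_entropy_antimono) (auto simp: b_def)
    also have "\<dots> = real (b - a) * (step_entropy a - step_entropy (a + m))" by simp
    also have "\<dots> \<le> real m * (step_entropy a - step_entropy (a + m))"
      using step_entropy_antimono[of a "a + m"] by (intro mult_right_mono) (auto simp: b_def)
    finally show ?thesis using assms by (intro add_left_mono divide_right_mono) auto
  qed
  finally show ?thesis .
qed

text \<open>The choice of the parameter \<open>c\<close> proportional to the block length makes the bound telescope
  along the recursion tree.\<close>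

lemma average_burden_le:
  assumes "0 < \<kappa>"
  shows "average (\<lambda>\<sigma>. burden J \<tau> l (take a \<sigma>) (take (2 ^ l) (drop a \<sigma>)))
    \<le> 8 * (real l * real J * (\<kappa> * 2 ^ l + (step_entropy a - step_entropy (a + 2 ^ l)) / \<kappa>) + (2 ^ l - 1) * \<tau>)"
proof (induction l arbitrary: a)
  case 0
  show ?case by (simp add: average_const)
next
  case (Suc l)
  let ?t = "\<lambda>\<sigma>. measure_pmf.expectation (sequential \<pi> (take a \<sigma>) Map.empty)
      (\<lambda>h. rejection (sequential \<pi> (take (2 ^ Suc l) (drop a \<sigma>)) h) (factorized \<pi> h (take (2 ^ Suc l) (drop a \<sigma>)) h))"
  define d1 where "d1 = step_entropy a - step_entropy (a + 2 ^ l)"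
  define d2 where "d2 = step_entropy (a + 2 ^ l) - step_entropy (a + 2 ^ l + 2 ^ l)"
  have d: "step_entropy a - step_entropy (a + 2 ^ Suc l) = d1 + d2"
    by (simp add: d1_def d2_def mult_2 add.assoc)
  have burden: "burden J \<tau> (Suc l) (take a \<sigma>) (take (2 ^ Suc l) (drop a \<sigma>))
     = 8 * (real J * ?t \<sigma> + \<tau>) + (burden J \<tau> l (take a \<sigma>) (take (2 ^ l) (drop a \<sigma>))
       + burden J \<tau> l (take (a + 2 ^ l) \<sigma>) (take (2 ^ l) (drop (a + 2 ^ l) \<sigma>)))" for \<sigma>
  proof -
    have "take (2 ^ l) (take (2 ^ Suc l) (drop a \<sigma>)) = take (2 ^ l) (drop a \<sigma>)" by simp
    moreover have "drop (2 ^ l) (take (2 ^ Suc l) (drop a \<sigma>)) = take (2 ^ l) (drop (a + 2 ^ l) \<sigma>)"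
      by (simp add: drop_take add.commute)
    ultimately show ?thesis unfolding burden.simps take_add by (simp only:)
  qed
  have "average (\<lambda>\<sigma>. burden J \<tau> (Suc l) (take a \<sigma>) (take (2 ^ Suc l) (drop a \<sigma>)))
     = 8 * (real J * average ?t + \<tau>) + (average (\<lambda>\<sigma>. burden J \<tau> l (take a \<sigma>) (take (2 ^ l) (drop a \<sigma>)))
       + average (\<lambda>\<sigma>. burden J \<tau> l (take (a + 2 ^ l) \<sigma>) (take (2 ^ l) (drop (a + 2 ^ l) \<sigma>))))"
    unfolding burden average_add average_cmult average_const ..
  also have "\<dots> \<le> 8 * (real J * (\<kappa> * 2 ^ Suc l + (d1 + d2) / \<kappa>) + \<tau>)
      + (8 * (real l * real J * (\<kappa> * 2 ^ l + d1 / \<kappa>) + (2 ^ l - 1) * \<tau>)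
      + 8 * (real l * real J * (\<kappa> * 2 ^ l + d2 / \<kappa>) + (2 ^ l - 1) * \<tau>))"
  proof (intro add_mono mult_left_mono)
    show "average ?t \<le> \<kappa> * 2 ^ Suc l + (d1 + d2) / \<kappa>"
      using average_rejection_le[of "\<kappa> * 2 ^ Suc l" a "2 ^ Suc l"] assms unfolding d by simp
  qed (use Suc[of a] Suc[of "a + 2 ^ l"] in \<open>simp_all add: d1_def d2_def\<close>)
  \<comment> \<open>Each level adds the same amount, as lengths and entropy drops of the two halves
    add up to those of the block; the \<open>2 ^ Suc l - 1\<close> inner nodes carry one
    \<open>\<tau>\<close> each.\<close>
  also have "\<dots> = 8 * (real (Suc l) * real J * (\<kappa> * 2 ^ Suc l + (d1 + d2) / \<kappa>) + (2 ^ Suc l - 1) * \<tau>)"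
    by (simp add: algebra_simps add_divide_distrib)
  finally show ?case unfolding d .
qed

end

section \<open>Recursion depth and choice of parameters\<close>

definition depth :: "nat \<Rightarrow> nat" where
  "depth n = (LEAST l. n \<le> 2 ^ l)"

lemma le_power_depth: "n \<le> 2 ^ depth n"
  unfolding depth_def by (rule LeastI[of _ n]) (simp add: less_imp_le)

lemma depth_pos: "2 \<le> n \<Longrightarrow> 0 < depth n"
  using le_power_depth[of n] by (cases "depth n") auto

lemma power_depth_le: "2 \<le> n \<Longrightarrow> 2 ^ depth n \<le> 2 * n"
proof -
  assume n: "2 \<le> n"
  obtain l where l: "depth n = Suc l" using depth_pos[OF n] by (cases "depth n") auto
  have "\<not> n \<le> 2 ^ l" using not_less_Least[of l "\<lambda>l. n \<le> 2 ^ l"] l by (simp add: depth_def)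
  then show ?thesis by (simp add: l)
qed

lemma depth_le: "2 \<le> n \<Longrightarrow> real (depth n) \<le> 3 * ln (real n)"
proof -
  assume n: "2 \<le> n"
  have "real (2 ^ depth n) \<le> real (2 * n)" using power_depth_le[OF n] by (rule of_nat_mono)
  then have "ln (2 ^ depth n) \<le> ln (2 * real n)" using n by simp
  then have "real (depth n) * ln 2 \<le> ln 2 + ln (real n)"
    using n by (simp add: ln_realpow ln_mult)
  also have "\<dots> \<le> 2 * ln (real n)" using n by simp
  finally have "real (depth n) * ln 2 \<le> 2 * ln (real n)" .
  moreover have "real (depth n) * (2 / 3) \<le> real (depth n) * ln 2"
    using ln2_ge_two_thirds by (intro mult_left_mono) auto
  ultimately show ?thesis by simp
qed

definition order_sampler :: "nat \<Rightarrow> nat \<Rightarrow> config prog" where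
  "order_sampler n q = bindp (coin (pmf_of_set (permutations_of_set {1..n})))
     (\<lambda>\<sigma>. sampler (depth n) q (depth n) \<sigma> Map.empty)"

text \<open>With \<open>L\<close> equal to the recursion depth, the upper bound keeps the overshoot
  accumulated over all levels constant. By the lower bound, the growth over \<open>L\<close> batches
  is at least a doubling, which limits the number of relevant batches.\<close>

lemma growth_bounds:
  assumes "0 < L"
  shows "(1 + 1 / real L) ^ L \<le> 3" "2 \<le> (1 + 1 / real L) ^ L"
proof -
  have "(1 + 1 / real L) ^ L \<le> exp (1 / real L) ^ L"
    by (intro power_mono exp_ge_add_one_self) auto
  also have "\<dots> = exp 1" using assms by (simp add: exp_of_nat_mult[symmetric])
  also have "\<dots> \<le> 3" by (rule exp_le)
  finally show "(1 + 1 / real L) ^ L \<le> 3" .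
  have "1 + real L * (1 / real L) \<le> (1 + 1 / real L) ^ L"
    by (intro Bernoulli_inequality) (auto intro: order_trans[of _ 0])
  then show "2 \<le> (1 + 1 / real L) ^ L" using assms by simp
qed

context conditional_queries
begin

lemma block_order: "\<sigma> \<in> orders \<Longrightarrow> block \<sigma> Map.empty"
  using ordersD[of \<sigma>] by (simp add: block_empty_iff)

lemma set_pmf_orders: "set_pmf (pmf_of_set orders) = orders"
  by (intro set_pmf_of_set) (simp_all add: finite_permutations_of_set)

lemma length_order: "\<sigma> \<in> orders \<Longrightarrow> length \<sigma> \<le> 2 ^ depth n"
  using ordersD[of \<sigma>] le_power_depth[of n] by simp

lemma law_order_sampler:
  assumes "2 \<le> n"
  shows "law orc (order_sampler n q) = \<pi>"
proof -
  have "law orc (order_sampler n q) = bind_pmf (pmf_of_set orders) (\<lambda>\<sigma>. \<pi>)"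
    unfolding order_sampler_def law_bindp law_coin
    using law_sampler[OF depth_pos[OF assms] block_order length_order] sequential_full[OF block_order] ordersD(1)
    by (intro bind_pmf_cong refl) (simp add: set_pmf_orders)
  then show ?thesis by simp
qed

lemma cost_order_sampler:
  assumes "2 \<le> n"
  shows "cost orc (order_sampler n q) \<le> ennreal (90 * (real n * ln (real n)))"
proof -
  let ?L = "depth n"
  have "cost orc (order_sampler n q) = (\<integral>\<^sup>+\<sigma>. cost orc (sampler ?L q ?L \<sigma> Map.empty) \<partial>pmf_of_set orders)"
    by (simp add: order_sampler_def)
  also have "\<dots> \<le> (\<integral>\<^sup>+\<sigma>. ennreal (90 * (real n * ln (real n))) \<partial>pmf_of_set orders)"
  proof (intro nn_integral_mono_AE AE_pmfI)
    fix \<sigma> assume "\<sigma> \<in> set_pmf (pmf_of_set orders)"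
    then have \<sigma>: "\<sigma> \<in> orders" by (simp add: set_pmf_orders)
    have "cost orc (sampler ?L q ?L \<sigma> Map.empty)
       \<le> ennreal ((1 + 1 / real ?L) ^ ?L * (9 * real ?L + 1) * real (length \<sigma>))"
      by (rule cost_sampler[OF depth_pos[OF assms] block_order[OF \<sigma>] length_order[OF \<sigma>]])
    also have "\<dots> \<le> ennreal (90 * (real n * ln (real n)))"
    proof (rule ennreal_leI)
      \<comment> \<open>The constant 90 is \<open>3 * 10 * 3\<close>: growth at most 3,
        \<open>9 * L + 1 \<le> 10 * L\<close>, and \<open>L \<le> 3 * ln n\<close>.\<close>
      have "(1 + 1 / real ?L) ^ ?L * (9 * real ?L + 1) \<le> 3 * (10 * real ?L)"
        using growth_bounds(1)[OF depth_pos[OF assms]] depth_pos[OF assms] by (intro mult_mono) auto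
      also have "\<dots> \<le> 90 * ln (real n)" using depth_le[OF assms] by simp
      finally have "(1 + 1 / real ?L) ^ ?L * (9 * real ?L + 1) * real n \<le> 90 * ln (real n) * real n"
        by (rule mult_right_mono) simp
      then show "(1 + 1 / real ?L) ^ ?L * (9 * real ?L + 1) * real (length \<sigma>) \<le> 90 * (real n * ln (real n))"
        using ordersD(3)[OF \<sigma>] by (simp add: mult_ac)
    qed
    finally show "cost orc (sampler ?L q ?L \<sigma> Map.empty) \<le> ennreal (90 * (real n * ln (real n)))" .
  qed
  finally show ?thesis by simp
qed

lemma excess_order_sampler:
  assumes "2 \<le> n" "2 \<le> q"
  shows "excess orc 0 (order_sampler n q) \<le> ennreal (4000 * (sqrt (real n * ln (real q)) * ln (real n) ^ 3))"
proof -
  define L where "L = depth n"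
  \<comment> \<open>After \<open>2 * L * L\<close> batches the growth is at least
    \<open>4 ^ L\<close>: one factor \<open>2 ^ L\<close> absorbs \<open>L + 1\<close>, the other
    the number of nodes, so the tails \<open>\<tau>\<close> of the whole tree total at most
    1.\<close>
  define J where "J = 2 * L * L"
  define \<tau> where "\<tau> = (real L + 1) / (1 + 1 / real L) ^ J"
  define s where "s = sqrt (real n * ln (real q))"
  \<comment> \<open>Balances the contributions \<open>\<kappa> * n\<close> and
    \<open>ln q / \<kappa>\<close> to the burden: both equal \<open>s\<close>.\<close>
  define \<kappa> where "\<kappa> = sqrt (ln (real q) / real n)"
  have L: "0 < L" unfolding L_def by (rule depth_pos[OF assms(1)])
  have lnq: "ln 2 \<le> ln (real q)" using assms by simp
  then have lnq0: "0 < ln (real q)" using ln2_ge_two_thirds by linarith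
  have \<kappa>: "0 < \<kappa>" using lnq0 assms by (simp add: \<kappa>_def)
  have \<tau>0: "0 \<le> \<tau>" by (simp add: \<tau>_def)
  have power: "2 ^ L \<le> 2 * real n"
    using of_nat_mono[OF power_depth_le[OF assms(1)], where 'a = real] by (simp add: L_def)
  have \<tau>: "2 ^ L * \<tau> \<le> 1"
  proof -
    have "((2::real) ^ 2) ^ L \<le> (((1 + 1 / real L) ^ L) ^ 2) ^ L"
      using growth_bounds(2)[OF L] by (intro power_mono) auto
    also have "\<dots> = (1 + 1 / real L) ^ J" by (simp add: J_def power_mult[symmetric] mult_ac)
    finally have 4: "2 ^ L * 2 ^ L \<le> (1 + 1 / real L) ^ J" by (simp add: power_mult_distrib[symmetric])
    have "real (L + 1) \<le> real (2 ^ L)" by (intro of_nat_mono) (metis Suc_eq_plus1 Suc_leI less_exp)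
    then have "2 ^ L * (real L + 1) \<le> 2 ^ L * 2 ^ L" by simp
    also note 4
    finally have "2 ^ L * (real L + 1) \<le> (1 + 1 / real L) ^ J" .
    moreover have "0 < (1 + 1 / real L) ^ J" by (intro zero_less_power add_pos_nonneg) auto
    ultimately show ?thesis by (simp add: \<tau>_def divide_le_eq)
  qed
  have \<kappa>s: "\<kappa> * real n = s" "ln (real q) / \<kappa> = s"
  proof -
    have "\<kappa> * real n = sqrt (ln (real q) / real n) * sqrt (real n * real n)" by (simp add: \<kappa>_def)
    also have "\<dots> = sqrt (ln (real q) / real n * (real n * real n))" by (rule real_sqrt_mult[symmetric])
    also have "ln (real q) / real n * (real n * real n) = real n * ln (real q)" using assms by simp
    finally show "\<kappa> * real n = s" by (simp add: s_def)
    have "\<kappa> * s = sqrt (ln (real q) / real n * (real n * ln (real q)))"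
      unfolding \<kappa>_def s_def by (rule real_sqrt_mult[symmetric])
    also have "ln (real q) / real n * (real n * ln (real q)) = ln (real q) * ln (real q)" using assms by simp
    finally have "\<kappa> * s = ln (real q)" using lnq0 by simp
    then show "ln (real q) / \<kappa> = s" using \<kappa> by (simp add: field_simps)
  qed
  have avg: "average (\<lambda>\<sigma>. burden J \<tau> L [] \<sigma>) \<le> 24 * (real L * real J * s) + 8"
  proof -
    have "average (\<lambda>\<sigma>. burden J \<tau> L [] \<sigma>) = average (\<lambda>\<sigma>. burden J \<tau> L (take 0 \<sigma>) (take (2 ^ L) (drop 0 \<sigma>)))"
      unfolding average_def L_def using length_order by (intro arg_cong2[where f = "(/)"] sum.cong refl) simp
    also have "\<dots> \<le> 8 * (real L * real J * (\<kappa> * 2 ^ L + (step_entropy 0 - step_entropy (0 + 2 ^ L)) / \<kappa>) + (2 ^ L - 1) * \<tau>)"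
      by (rule average_burden_le[OF \<kappa>])
    also have "\<dots> \<le> 8 * (real L * real J * (\<kappa> * (2 * real n) + ln (real q) / \<kappa>) + 1)"
    proof (intro mult_left_mono add_mono divide_right_mono)
      show "step_entropy 0 - step_entropy (0 + 2 ^ L) \<le> ln (real q)"
        using step_entropy_0 step_entropy_nonneg[of "0 + 2 ^ L"] assms by simp
      show "(2 ^ L - 1) * \<tau> \<le> 1" using \<tau> \<tau>0 by (simp add: left_diff_distrib)
    qed (use power \<kappa> in auto)
    also have "\<dots> = 24 * (real L * real J * s) + 8"
      using \<kappa>s by (simp add: algebra_simps)
    finally show ?thesis .
  qed
  have s1: "1 \<le> s"
  proof -
    have "1 \<le> 2 * ln (2::real)" using ln2_ge_two_thirds by simp
    also have "\<dots> \<le> real n * ln (real q)" using assms lnq by (intro mult_mono) auto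
    finally show ?thesis by (simp add: s_def)
  qed
  have lnn: "2 / 3 \<le> ln (real n)"
  proof -
    have "ln 2 \<le> ln (real n)" using assms by simp
    then show ?thesis using ln2_ge_two_thirds by linarith
  qed
  \<comment> \<open>The additional round draws the order.\<close>
  have "excess orc (1 + 3) (order_sampler n q)
     \<le> excess orc 1 (coin (pmf_of_set orders)) + (\<integral>\<^sup>+\<sigma>. excess orc 3 (sampler L q L \<sigma> Map.empty) \<partial>law orc (coin (pmf_of_set orders)))"
    unfolding order_sampler_def L_def by (rule excess_bindp)
  also have "\<dots> = (\<integral>\<^sup>+\<sigma>. excess orc 3 (sampler L q L \<sigma> Map.empty) \<partial>pmf_of_set orders)" by simp
  also have "\<dots> \<le> (\<integral>\<^sup>+\<sigma>. ennreal (3 * burden J \<tau> L [] \<sigma>) \<partial>pmf_of_set orders)"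
  proof (intro nn_integral_mono_AE AE_pmfI)
    fix \<sigma> assume "\<sigma> \<in> set_pmf (pmf_of_set orders)"
    then have \<sigma>: "\<sigma> \<in> orders" by (simp add: set_pmf_orders)
    have "excess orc 3 (sampler L q L \<sigma> Map.empty) \<le> ennreal ((1 + 1 / real L) ^ L * burden J \<tau> L [] \<sigma>)"
      using excess_sampler[OF L, of "[]" \<sigma> L J] block_order[OF \<sigma>] length_order[OF \<sigma>]
      by (simp add: L_def \<tau>_def)
    also have "\<dots> \<le> ennreal (3 * burden J \<tau> L [] \<sigma>)"
      using growth_bounds(1)[OF L] burden_nonneg[OF \<tau>0] by (intro ennreal_leI mult_right_mono)
    finally show "excess orc 3 (sampler L q L \<sigma> Map.empty) \<le> ennreal (3 * burden J \<tau> L [] \<sigma>)" .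
  qed
  also have "\<dots> = ennreal (measure_pmf.expectation (pmf_of_set orders) (\<lambda>\<sigma>. 3 * burden J \<tau> L [] \<sigma>))"
    by (intro nn_integral_pmf_finite) (auto simp: set_pmf_orders burden_nonneg[OF \<tau>0])
  also have "measure_pmf.expectation (pmf_of_set orders) (\<lambda>\<sigma>. 3 * burden J \<tau> L [] \<sigma>) = 3 * average (\<lambda>\<sigma>. burden J \<tau> L [] \<sigma>)"
    by (subst integral_pmf_of_set) (simp_all add: average_def sum_distrib_left)
  also have "ennreal (3 * average (\<lambda>\<sigma>. burden J \<tau> L [] \<sigma>)) \<le> ennreal (72 * (real L * real J * s) + 24)"
    using avg by (intro ennreal_leI) simp
  finally have ex: "excess orc 4 (order_sampler n q) \<le> ennreal (72 * (real L * real J * s) + 24)" by simp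
  have "excess orc 0 (order_sampler n q) \<le> of_nat 4 + excess orc 4 (order_sampler n q)"
    by (rule excess_0_le)
  also have "\<dots> \<le> ennreal 4 + ennreal (72 * (real L * real J * s) + 24)"
    using ex by (intro add_mono) simp_all
  also have "\<dots> = ennreal (4 + (72 * (real L * real J * s) + 24))"
    using s1 by (intro ennreal_plus[symmetric]) auto
  also have "\<dots> \<le> ennreal (4000 * (s * ln (real n) ^ 3))"
  proof (rule ennreal_leI)
    \<comment> \<open>The main term has the constant \<open>72 * 2 * 27 = 3888\<close>. The additive
      28 is absorbed through \<open>s * ln n ^ 3 \<ge> 8 / 27\<close> at the price of 94.5, which
      leaves the total below 4000.\<close>
    have "real L ^ 3 \<le> (3 * ln (real n)) ^ 3"
      using depth_le[OF assms(1)] by (intro power_mono) (auto simp: L_def)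
    then have "real L ^ 3 \<le> 27 * ln (real n) ^ 3" by (simp add: power_mult_distrib)
    then have "real L ^ 3 * s \<le> 27 * ln (real n) ^ 3 * s" using s1 by (intro mult_right_mono) auto
    then have "real L ^ 3 * s \<le> 27 * (s * ln (real n) ^ 3)" by (simp only: mult_ac)
    moreover have "real L * real J * s = 2 * (real L ^ 3 * s)" by (simp add: J_def power3_eq_cube)
    moreover have "8 / 27 \<le> s * ln (real n) ^ 3"
    proof -
      have "(2 / 3) ^ 3 \<le> ln (real n) ^ 3" using lnn by (intro power_mono) auto
      also have "\<dots> \<le> s * ln (real n) ^ 3"
        using s1 lnn mult_right_mono[of 1 s "ln (real n) ^ 3"] by simp
      finally show ?thesis by (simp add: power3_eq_cube)
    qed
    ultimately show "4 + (72 * (real L * real J * s) + 24) \<le> 4000 * (s * ln (real n) ^ 3)"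
      by linarith
  qed
  finally show ?thesis by (simp add: s_def)
qed

end

section \<open>Transfer to algorithms\<close>

lemma outputs_to_algorithm: "map_spmf result (exec orc (to_algorithm p)) = spmf_of_pmf (law orc p)"
  by (simp add: exec_to_algorithm law_def map_spmf_of_pmf pmf.map_comp o_def case_prod_unfold)

lemma expected_rounds_to_algorithm: "expected_rounds orc (to_algorithm p) = excess orc 0 p"
  by (simp add: expected_rounds_def excess_def exec_to_algorithm case_prod_unfold)

lemma expected_queries_to_algorithm: "expected_queries orc (to_algorithm p) = cost orc p"
  by (simp add: expected_queries_def cost_def exec_to_algorithm case_prod_unfold)

lemma configs_1: "configs S 1 = {\<lambda>i. if i \<in> S then Some 1 else None}"
proof (intro equalityI subsetI)
  fix x assume "x \<in> configs S 1"
  then have "x i = (if i \<in> S then Some 1 else None)" for i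
    by (cases "x i") (auto simp: configs_def ran_def dom_def)
  then show "x \<in> {\<lambda>i. if i \<in> S then Some 1 else None}" by auto
qed (auto simp: configs_def ran_def dom_def split: if_splits)

theorem theorem27:
  shows "\<exists>(A :: nat \<Rightarrow> nat \<Rightarrow> algorithm) (C :: real).
    \<forall>(n :: nat) (q :: nat) (\<pi> :: config pmf) (orc :: query \<Rightarrow> answer pmf).
      2 \<le> n \<longrightarrow> 1 \<le> q \<longrightarrow> set_pmf \<pi> \<subseteq> configs {1..n} q \<longrightarrow> conditional_oracle n q \<pi> orc \<longrightarrow>
        outputs_exactly orc (A n q) \<pi> \<and>
        expected_rounds orc (A n q) \<le> ennreal (C * (sqrt (real n * ln (real q)) * ln (real n) ^ 3)) \<and>
        expected_queries orc (A n q) \<le> ennreal (C * (real n * ln (real n)))"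
proof -
  \<comment> \<open>For \<open>q = 1\<close> the bound on the rounds is 0, so the unique
    configuration has to be output at once; even the toss for the order would be too much.\<close>
  define A where "A n q = to_algorithm (if q = 1
    then Ret (\<lambda>i. if i \<in> {1..n} then Some 1 else None) else order_sampler n q)" for n q :: nat
  have "outputs_exactly orc (A n q) \<pi> \<and>
        expected_rounds orc (A n q) \<le> ennreal (4000 * (sqrt (real n * ln (real q)) * ln (real n) ^ 3)) \<and>
        expected_queries orc (A n q) \<le> ennreal (4000 * (real n * ln (real n)))"
    if n: "2 \<le> n" and q: "1 \<le> q" and \<pi>: "set_pmf \<pi> \<subseteq> configs {1..n} q" "conditional_oracle n q \<pi> orc"
    for n q \<pi> orc
  proof (cases "q = 1")
    case True
    have "\<pi> = return_pmf (\<lambda>i. if i \<in> {1..n} then Some 1 else None)"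
      using \<pi>(1) unfolding True configs_1 set_pmf_subset_singleton .
    then show ?thesis
      using True by (simp add: A_def outputs_exactly_def outputs_to_algorithm
          expected_rounds_to_algorithm expected_queries_to_algorithm del: to_algorithm.simps)
  next
    case False
    interpret conditional_queries n q \<pi> orc by unfold_locales (fact \<pi>)+
    have A: "A n q = to_algorithm (order_sampler n q)" using False by (simp add: A_def)
    have "cost orc (order_sampler n q) \<le> ennreal (4000 * (real n * ln (real n)))"
      using n by (intro order_trans[OF cost_order_sampler] ennreal_leI mult_right_mono) auto
    then show ?thesis
      using law_order_sampler[OF n] excess_order_sampler[OF n] False q
      by (simp add: A outputs_exactly_def outputs_to_algorithm
          expected_rounds_to_algorithm expected_queries_to_algorithm)
  qed
  then show ?thesis by blast
qed

end
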